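(* Let $\phi(\bar{x})$, with $\bar{x}$ an $n$-tuple of variables, be an existential formula without the equality symbol over the structure $\mathbb{R}_{\operatorname{ECF}}$. Then the set of rational tuples $\bar{a}\in\mathbb{Q}^n$ with $\mathbb{R}_{\operatorname{ECF}}\models\phi(\bar{a})$ is recursively enumerable. Moreover, the complexity class $\exists\mathbb{R}^{<}_{\operatorname{ECF}}$ is contained in $\Sigma^0_1$.
   Context: A function $f\colon\mathbb{R}^n\to\mathbb{R}$ is effectively continuous if there is a computable function $g$ such that: (1) to each $n$-tuple of open intervals $(a_1,b_1),\dots,(a_n,b_n)$ with rational endpoints, $g$ associates an open interval $(c,d)$ with rational endpoints such that $f(x)\in(c,d)$ for all $x\in(a_1,b_1)\times\dots\times(a_n,b_n)$; (2) for all $M>0$ and $\varepsilon>0$ there is $\delta>0$ such that for all $a_i,b_i$, if $(c,d)$ is the output of $g$ on $(a_i,b_i)_i$, all $(a_i,b_i)\subseteq[-M,M]$ and all $|a_i-b_i|<\delta$, then $|c-d|<\varepsilon$. $\operatorname{ECF}$ is the set of all effectively continuous functions (each given by a code of a computable $g$ computing it). $\mathbb{R}_{\operatorname{ECF}}$ is the structure $(\mathbb{R},+,\times,<,=,0,1)$ expanded with function symbols for all functions in $\operatorname{ECF}$; $\mathbb{R}^<_{\operatorname{ECF}}$ is the same without $=$. Existential formulae are built from atoms $t<t'$ (and $t=t'$ when equality is allowed) with terms over these symbols, using $\land$, $\lor$, $\exists$ only. $\exists\mathbb{R}^{<}_{\operatorname{ECF}}$ is the class of decision problems polynomial-time many-one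 reducible to the set of existential sentences without equality true in $\mathbb{R}^{<}_{\operatorname{ECF}}$. $\Sigma^0_1$ is the class of recursively enumerable sets (first level of the arithmetical hierarchy).
   Formalization: Reductions defining the class must send every word to an actual equality-free existential sentence whose function codes are all valid; if words with invalid codes counted as no-instances, the non-r.e. set of valid codes would reduce to the problem and the inclusion in Σ⁰₁ would fail. *)

theory Defs
  imports Complex_Main "HOL-Library.Nat_Bijection"
begin

section \<open>Partial recursive functions and recursively enumerable sets\<close>

datatype rec_code =
    Zero
  | Succ
  | Proj nat
  | Comp rec_code "rec_code list"
  | PrimRec rec_code rec_code
  | Minim rec_code

text \<open>
  \<open>rec_computes e xs y\<close>: the partial recursive function with program \<open>e\<close> is defined at \<open>xs\<close>, with
  value \<open>y\<close>. Arities are not tracked syntactically; a program applied to an argument list of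
  unsuitable length may simply be undefined.
\<close>

inductive rec_computes :: "rec_code \<Rightarrow> nat list \<Rightarrow> nat \<Rightarrow> bool" where
  rc_Zero: "rec_computes Zero xs 0"
| rc_Succ: "rec_computes Succ [x] (Suc x)"
| rc_Proj: "i < length xs \<Longrightarrow> rec_computes (Proj i) xs (xs ! i)"
| rc_Comp: "list_all2 (\<lambda>g y. rec_computes g xs y) gs ys \<Longrightarrow> rec_computes f ys z
    \<Longrightarrow> rec_computes (Comp f gs) xs z"
| rc_PrimRec_0: "rec_computes f xs y \<Longrightarrow> rec_computes (PrimRec f g) (0 # xs) y"
| rc_PrimRec_Suc: "rec_computes (PrimRec f g) (n # xs) r \<Longrightarrow> rec_computes g (n # r # xs) y
    \<Longrightarrow> rec_computes (PrimRec f g) (Suc n # xs) y"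
| rc_Minim: "rec_computes f (n # xs) 0 \<Longrightarrow> \<forall>i<n. \<exists>m. rec_computes f (i # xs) (Suc m)
    \<Longrightarrow> rec_computes (Minim f) xs n"

lemma rec_computes_unique:
  "rec_computes e xs y \<Longrightarrow> rec_computes e xs z \<Longrightarrow> y = z"
proof (induction arbitrary: z rule: rec_computes.induct)
  case (rc_Comp xs gs ys f w)
  from rc_Comp.prems obtain ys' where ys': "list_all2 (\<lambda>g y. rec_computes g xs y) gs ys'"
    "rec_computes f ys' z" by cases auto
  have "ys = ys'"
    using rc_Comp.IH(1) ys'(1) by (auto simp: list_all2_conv_all_nth intro!: nth_equalityI)
  with rc_Comp.IH(2) ys'(2) show ?case by simp
next
  case (rc_Minim f n xs)
  from rc_Minim.prems have z: "rec_computes f (z # xs) 0"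
    "\<forall>i<z. \<exists>m. rec_computes f (i # xs) (Suc m)" by (cases, auto)+
  have "\<not> z < n" using rc_Minim.IH(2) z(1) by fastforce
  moreover have "\<not> n < z" using rc_Minim.IH(1) z(2) by fastforce
  ultimately show ?case by simp
next
  case (rc_PrimRec_Suc f g n xs r y)
  from rc_PrimRec_Suc.prems obtain r' where "rec_computes (PrimRec f g) (n # xs) r'"
    "rec_computes g (n # r' # xs) z" by cases auto
  with rc_PrimRec_Suc.IH show ?case by metis
next
  case (rc_Zero xs)
  then show ?case by cases auto
next
  case (rc_Succ x)
  then show ?case by cases auto
next
  case (rc_Proj i xs)
  from rc_Proj.prems show ?case by cases auto
next
  case (rc_PrimRec_0 f xs y g)
  from rc_PrimRec_0.prems rc_PrimRec_0.IH show ?case by cases auto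
qed

definition re_nat :: "nat set \<Rightarrow> bool" where
  "re_nat A \<longleftrightarrow> (\<exists>e. \<forall>x. x \<in> A \<longleftrightarrow> (\<exists>y. rec_computes e [x] y))"

definition rat_code :: "rat \<Rightarrow> nat" where
  "rat_code q = (let (a, b) = quotient_of q in prod_encode (int_encode a, nat b))"

lemma inj_rat_code: "inj rat_code"
proof (rule injI)
  fix p q assume *: "rat_code p = rat_code q"
  obtain a b c d where "quotient_of p = (a, b)" "quotient_of q = (c, d)" by (metis surj_pair)
  moreover from this have "b > 0" "d > 0" by (auto intro: quotient_of_denom_pos)
  ultimately show "p = q" using *
    by (auto simp: rat_code_def int_encode_eq nat_eq_iff intro!: quotient_of_inject split: if_splits)
qed

definition re_rat_tuples :: "rat list set \<Rightarrow> bool" where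
  "re_rat_tuples A \<longleftrightarrow> re_nat ((\<lambda>as. list_encode (map rat_code as)) ` A)"

text \<open>Decision problems are languages over the alphabet \<open>bool\<close>.\<close>

definition Sigma01 :: "bool list set set" where
  "Sigma01 = {L. re_nat ((\<lambda>w. list_encode (map of_bool w)) ` L)}"


section \<open>Polynomial-time computable functions\<close>

text \<open>
  Deterministic one-tape Turing machines, given by a transition table. States and symbols are
  natural numbers, \<open>0\<close> being the initial state and the blank symbol, respectively; the machine halts
  when no transition applies. A configuration \<open>(q, l, r)\<close> has state \<open>q\<close>; \<open>l\<close> is the part of the tape
  to the left of the head, nearest cell first, and \<open>r\<close> is the rest of the tape, starting with the
  scanned cell. Both parts extend by blanks.
\<close>

datatype direction = L_move | R_move

type_synonym tm = "nat \<times> nat \<Rightarrow> (nat \<times> nat \<times> direction) option"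
type_synonym tm_config = "nat \<times> nat list \<times> nat list"

definition scanned :: "nat list \<Rightarrow> nat" where
  "scanned r = (case r of [] \<Rightarrow> 0 | a # _ \<Rightarrow> a)"

fun tm_step :: "tm \<Rightarrow> tm_config \<Rightarrow> tm_config option" where
  "tm_step M (q, l, r) =
    (case M (q, scanned r) of
       None \<Rightarrow> None
     | Some (q', b, L_move) \<Rightarrow> Some (q', tl l, scanned l # b # tl r)
     | Some (q', b, R_move) \<Rightarrow> Some (q', b # l, tl r))"

fun tm_reaches :: "tm \<Rightarrow> nat \<Rightarrow> tm_config \<Rightarrow> tm_config \<Rightarrow> bool" where
  "tm_reaches M 0 c c' \<longleftrightarrow> c = c'"
| "tm_reaches M (Suc t) c c' \<longleftrightarrow> (\<exists>c''. tm_step M c = Some c'' \<and> tm_reaches M t c'' c')"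

definition tape_of :: "bool list \<Rightarrow> nat list" where
  "tape_of w = map (\<lambda>b. if b then 2 else 1) w"

text \<open>
  The output is the content of the tape from the scanned cell up to the next blank.
\<close>

definition tm_outputs_in :: "tm \<Rightarrow> nat \<Rightarrow> bool list \<Rightarrow> bool list \<Rightarrow> bool" where
  "tm_outputs_in M t w v \<longleftrightarrow>
    (\<exists>q l r. tm_reaches M t (0, [], tape_of w) (q, l, r) \<and> tm_step M (q, l, r) = None \<and>
       takeWhile (\<lambda>a. a \<noteq> 0) r = tape_of v)"

definition polytime_computable :: "(bool list \<Rightarrow> bool list) \<Rightarrow> bool" where
  "polytime_computable f \<longleftrightarrow>
    (\<exists>M c k. finite (dom M) \<and>
       (\<forall>w. \<exists>t \<le> c * length w ^ k + c. tm_outputs_in M t w (f w)))"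

text \<open>
  A decision problem is given by its set \<open>I\<close> of (encoded) instances and its set \<open>Y\<close> of
  yes-instances. A reduction to it maps every word to an instance.
\<close>

definition polytime_reducible :: "bool list set \<Rightarrow> bool list set \<times> bool list set \<Rightarrow> bool" where
  "polytime_reducible L P \<longleftrightarrow>
    (case P of (I, Y) \<Rightarrow>
      \<exists>f. polytime_computable f \<and> (\<forall>w. f w \<in> I) \<and> (\<forall>w. w \<in> L \<longleftrightarrow> f w \<in> Y))"


section \<open>Effectively continuous functions\<close>

text \<open>
  Points of \<open>\<real>\<^sup>n\<close> are lists of length \<open>n\<close>, and only the values of \<open>f :: real list \<Rightarrow> real\<close> on
  such lists matter. An \<open>n\<close>-tuple of open intervals is the list of the pairs of its endpoints.
\<close>

definition rat_intervals :: "nat \<Rightarrow> (rat \<times> rat) list set" where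
  "rat_intervals n = {J. length J = n \<and> (\<forall>(a, b) \<in> set J. a < b)}"

definition interval :: "rat \<times> rat \<Rightarrow> real set" where
  "interval J = {real_of_rat (fst J) <..< real_of_rat (snd J)}"

definition width :: "rat \<times> rat \<Rightarrow> real" where
  "width J = \<bar>real_of_rat (fst J) - real_of_rat (snd J)\<bar>"

definition box_of :: "(rat \<times> rat) list \<Rightarrow> real list set" where
  "box_of J = {xs. list_all2 (\<lambda>x K. x \<in> interval K) xs J}"

definition effectively_approximates ::
    "nat \<Rightarrow> ((rat \<times> rat) list \<Rightarrow> rat \<times> rat) \<Rightarrow> (real list \<Rightarrow> real) \<Rightarrow> bool" where
  "effectively_approximates n g f \<longleftrightarrow>
    (\<forall>J \<in> rat_intervals n. \<forall>xs \<in> box_of J. f xs \<in> interval (g J)) \<and>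
    (\<forall>M>0. \<forall>\<epsilon>>0. \<exists>\<delta>>0. \<forall>J \<in> rat_intervals n.
       (\<forall>K \<in> set J. interval K \<subseteq> {-M..M} \<and> width K < \<delta>) \<longrightarrow> width (g J) < \<epsilon>)"

definition rat_pair_code :: "rat \<times> rat \<Rightarrow> nat" where
  "rat_pair_code J = prod_encode (rat_code (fst J), rat_code (snd J))"

lemma inj_rat_pair_code: "inj rat_pair_code"
  by (rule injI) (simp add: rat_pair_code_def prod_eq_iff inj_eq[OF inj_rat_code])

text \<open>\<open>ecf_code n e f\<close>: the program \<open>e\<close> is a code of the effectively continuous \<open>n\<close>-ary function \<open>f\<close>.\<close>

definition ecf_code :: "nat \<Rightarrow> rec_code \<Rightarrow> (real list \<Rightarrow> real) \<Rightarrow> bool" where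
  "ecf_code n e f \<longleftrightarrow>
    (\<exists>g. (\<forall>J \<in> rat_intervals n. rec_computes e (map rat_pair_code J) (rat_pair_code (g J))) \<and>
         effectively_approximates n g f)"

definition effectively_continuous :: "nat \<Rightarrow> (real list \<Rightarrow> real) \<Rightarrow> bool" where
  "effectively_continuous n f \<longleftrightarrow> (\<exists>e. ecf_code n e f)"

lemma small_rat_interval:
  fixes x \<delta> :: real
  assumes "\<delta> > 0"
  obtains a b :: rat where "a < b" "x \<in> interval (a, b)" "width (a, b) < \<delta>"
    "interval (a, b) \<subseteq> {x - \<delta> .. x + \<delta>}"
proof -
  obtain a where a: "x - \<delta> / 2 < real_of_rat a" "real_of_rat a < x"
    using of_rat_dense[of "x - \<delta> / 2" x] assms by auto
  obtain b where b: "x < real_of_rat b" "real_of_rat b < x + \<delta> / 2"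
    using of_rat_dense[of x "x + \<delta> / 2"] assms by auto
  have "real_of_rat a < real_of_rat b" using a b by linarith
  then have "a < b" by (simp add: of_rat_less)
  with a b assms show thesis
    by (intro that[of a b]) (auto simp: interval_def width_def)
qed

text \<open>A code determines the coded function.\<close>

lemma ecf_code_unique:
  assumes f: "ecf_code n e f" and f': "ecf_code n e f'" and len: "length xs = n"
  shows "f xs = f' xs"
proof (rule ccontr)
  assume "f xs \<noteq> f' xs"
  then have pos: "\<bar>f xs - f' xs\<bar> > 0" by simp
  obtain g where g: "\<And>J. J \<in> rat_intervals n \<Longrightarrow>
      rec_computes e (map rat_pair_code J) (rat_pair_code (g J))"
    and g_f: "effectively_approximates n g f" using f by (auto simp: ecf_code_def)
  obtain g' where g': "\<And>J. J \<in> rat_intervals n \<Longrightarrow>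
      rec_computes e (map rat_pair_code J) (rat_pair_code (g' J))"
    and g'_f': "effectively_approximates n g' f'" using f' by (auto simp: ecf_code_def)
  have eq: "g J = g' J" if "J \<in> rat_intervals n" for J
    using rec_computes_unique[OF g[OF that] g'[OF that]] by (rule injD[OF inj_rat_pair_code])
  define M where "M = sum_list (map abs xs) + 1"
  have nonneg: "sum_list (map abs ys) \<ge> 0" for ys :: "real list" by (induction ys) auto
  have M: "\<bar>x\<bar> + 1 \<le> M" if "x \<in> set xs" for x
  proof -
    have "\<bar>x\<bar> \<le> sum_list (map abs xs)"
      using that by (induction xs) (auto intro: add_increasing add_increasing2 nonneg)
    then show ?thesis by (simp add: M_def)
  qed
  have "M > 0" using nonneg[of xs] by (simp add: M_def)
  then have "\<exists>\<delta>>0. \<forall>J \<in> rat_intervals n.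
      (\<forall>K \<in> set J. interval K \<subseteq> {-M..M} \<and> width K < \<delta>) \<longrightarrow> width (g J) < \<bar>f xs - f' xs\<bar>"
    using g_f pos unfolding effectively_approximates_def by simp
  then obtain \<delta> where \<delta>: "\<delta> > 0" and small:
    "\<And>J. J \<in> rat_intervals n \<Longrightarrow> \<forall>K \<in> set J. interval K \<subseteq> {-M..M} \<and> width K < \<delta> \<Longrightarrow>
      width (g J) < \<bar>f xs - f' xs\<bar>"
    by blast
  have "\<exists>K. fst K < snd K \<and> x \<in> interval K \<and> width K < \<delta> \<and> interval K \<subseteq> {x - 1 .. x + 1}" for x
  proof -
    obtain a b where "a < b" "x \<in> interval (a, b)" "width (a, b) < min \<delta> 1"
      "interval (a, b) \<subseteq> {x - min \<delta> 1 .. x + min \<delta> 1}"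
      using small_rat_interval[of "min \<delta> 1" x] \<delta> by auto
    moreover from this(4) have "interval (a, b) \<subseteq> {x - 1 .. x + 1}" by force
    ultimately show ?thesis by (intro exI[of _ "(a, b)"]) auto
  qed
  then obtain K where K: "\<And>x. fst (K x) < snd (K x)" "\<And>x. x \<in> interval (K x)"
    "\<And>x. width (K x) < \<delta>" "\<And>x. interval (K x) \<subseteq> {x - 1 .. x + 1}" by metis
  define J where "J = map K xs"
  have J: "J \<in> rat_intervals n" using K(1) len by (simp add: J_def rat_intervals_def case_prod_beta)
  have xs: "xs \<in> box_of J"
    using K(2) by (auto simp: J_def box_of_def list_all2_conv_all_nth)
  have "interval (K x) \<subseteq> {-M..M}" if "x \<in> set xs" for x
    using K(4)[of x] M[OF that] by force
  then have "width (g J) < \<bar>f xs - f' xs\<bar>"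
    using K(3) by (intro small J) (auto simp: J_def)
  moreover have "f xs \<in> interval (g J)" "f' xs \<in> interval (g J)"
    using g_f g'_f' J xs eq[OF J] by (auto simp: effectively_approximates_def)
  ultimately show False by (auto simp: interval_def width_def)
qed

definition ecf_fun :: "nat \<Rightarrow> rec_code \<Rightarrow> real list \<Rightarrow> real" where
  "ecf_fun n e = (SOME f. ecf_code n e f)"

lemma ecf_fun_eq: "ecf_code n e f \<Longrightarrow> length xs = n \<Longrightarrow> ecf_fun n e xs = f xs"
  unfolding ecf_fun_def by (metis ecf_code_unique someI)


section \<open>Existential formulae\<close>

text \<open>\<open>App e ts\<close> applies the symbol for the \<open>length ts\<close>-ary function coded by \<open>e\<close>.\<close>

datatype ecf_term =
    Var nat
  | Const0
  | Const1
  | Plus ecf_term ecf_term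
  | Times ecf_term ecf_term
  | App rec_code "ecf_term list"

datatype ex_formula =
    Less ecf_term ecf_term
  | Equal ecf_term ecf_term
  | Conj ex_formula ex_formula
  | Disj ex_formula ex_formula
  | Exists nat ex_formula

primrec term_value :: "(nat \<Rightarrow> real) \<Rightarrow> ecf_term \<Rightarrow> real" where
  "term_value s (Var v) = s v"
| "term_value s Const0 = 0"
| "term_value s Const1 = 1"
| "term_value s (Plus t u) = term_value s t + term_value s u"
| "term_value s (Times t u) = term_value s t * term_value s u"
| "term_value s (App e ts) = ecf_fun (length ts) e (map (term_value s) ts)"

primrec satisfies :: "(nat \<Rightarrow> real) \<Rightarrow> ex_formula \<Rightarrow> bool" where
  "satisfies s (Less t u) \<longleftrightarrow> term_value s t < term_value s u"
| "satisfies s (Equal t u) \<longleftrightarrow> term_value s t = term_value s u"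
| "satisfies s (Conj \<phi> \<psi>) \<longleftrightarrow> satisfies s \<phi> \<and> satisfies s \<psi>"
| "satisfies s (Disj \<phi> \<psi>) \<longleftrightarrow> satisfies s \<phi> \<or> satisfies s \<psi>"
| "satisfies s (Exists v \<phi>) \<longleftrightarrow> (\<exists>x. satisfies (s(v := x)) \<phi>)"

text \<open>Terms and formulae of the language of \<open>\<real>\<^bsub>ECF\<^esub>\<close>: all function symbols code members of ECF.\<close>

primrec term_over_ECF :: "ecf_term \<Rightarrow> bool" where
  "term_over_ECF (Var v) \<longleftrightarrow> True"
| "term_over_ECF Const0 \<longleftrightarrow> True"
| "term_over_ECF Const1 \<longleftrightarrow> True"
| "term_over_ECF (Plus t u) \<longleftrightarrow> term_over_ECF t \<and> term_over_ECF u"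
| "term_over_ECF (Times t u) \<longleftrightarrow> term_over_ECF t \<and> term_over_ECF u"
| "term_over_ECF (App e ts) \<longleftrightarrow> (\<exists>f. ecf_code (length ts) e f) \<and> list_all term_over_ECF ts"

primrec over_ECF :: "ex_formula \<Rightarrow> bool" where
  "over_ECF (Less t u) \<longleftrightarrow> term_over_ECF t \<and> term_over_ECF u"
| "over_ECF (Equal t u) \<longleftrightarrow> term_over_ECF t \<and> term_over_ECF u"
| "over_ECF (Conj \<phi> \<psi>) \<longleftrightarrow> over_ECF \<phi> \<and> over_ECF \<psi>"
| "over_ECF (Disj \<phi> \<psi>) \<longleftrightarrow> over_ECF \<phi> \<and> over_ECF \<psi>"
| "over_ECF (Exists v \<phi>) \<longleftrightarrow> over_ECF \<phi>"

primrec equality_free :: "ex_formula \<Rightarrow> bool" where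
  "equality_free (Less t u) \<longleftrightarrow> True"
| "equality_free (Equal t u) \<longleftrightarrow> False"
| "equality_free (Conj \<phi> \<psi>) \<longleftrightarrow> equality_free \<phi> \<and> equality_free \<psi>"
| "equality_free (Disj \<phi> \<psi>) \<longleftrightarrow> equality_free \<phi> \<and> equality_free \<psi>"
| "equality_free (Exists v \<phi>) \<longleftrightarrow> equality_free \<phi>"

primrec term_vars :: "ecf_term \<Rightarrow> nat set" where
  "term_vars (Var v) = {v}"
| "term_vars Const0 = {}"
| "term_vars Const1 = {}"
| "term_vars (Plus t u) = term_vars t \<union> term_vars u"
| "term_vars (Times t u) = term_vars t \<union> term_vars u"
| "term_vars (App e ts) = \<Union> (set (map term_vars ts))"

primrec free_vars :: "ex_formula \<Rightarrow> nat set" where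
  "free_vars (Less t u) = term_vars t \<union> term_vars u"
| "free_vars (Equal t u) = term_vars t \<union> term_vars u"
| "free_vars (Conj \<phi> \<psi>) = free_vars \<phi> \<union> free_vars \<psi>"
| "free_vars (Disj \<phi> \<psi>) = free_vars \<phi> \<union> free_vars \<psi>"
| "free_vars (Exists v \<phi>) = free_vars \<phi> - {v}"

text \<open>\<open>holds_at \<phi> vs as\<close>: truth of \<open>\<phi>(as)\<close>, where the tuple \<open>vs\<close> contains the free variables of \<open>\<phi>\<close>.\<close>

definition assignment :: "nat list \<Rightarrow> rat list \<Rightarrow> nat \<Rightarrow> real" where
  "assignment vs as v = (case map_of (zip vs as) v of Some a \<Rightarrow> real_of_rat a | None \<Rightarrow> 0)"

definition holds_at :: "ex_formula \<Rightarrow> nat list \<Rightarrow> rat list \<Rightarrow> bool" where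
  "holds_at \<phi> vs as \<longleftrightarrow> satisfies (assignment vs as) \<phi>"


section \<open>Formulae as words, and the complexity class\<close>

text \<open>
  Prefix notation; numbers are written in binary, each digit (least significant first) being
  preceded by \<open>True\<close>, with end marker \<open>False\<close>. Small numbers also serve as tags of the
  constructors, and an argument list is preceded by its length.
\<close>

fun nat_word :: "nat \<Rightarrow> bool list" where
  "nat_word n = (if n = 0 then [False] else True # odd n # nat_word (n div 2))"

declare nat_word.simps [simp del]

primrec rec_code_word :: "rec_code \<Rightarrow> bool list" where
  "rec_code_word Zero = nat_word 0"
| "rec_code_word Succ = nat_word 1"
| "rec_code_word (Proj i) = nat_word 2 @ nat_word i"
| "rec_code_word (Comp f gs) =
    nat_word 3 @ rec_code_word f @ nat_word (length gs) @ concat (map rec_code_word gs)"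
| "rec_code_word (PrimRec f g) = nat_word 4 @ rec_code_word f @ rec_code_word g"
| "rec_code_word (Minim f) = nat_word 5 @ rec_code_word f"

primrec term_word :: "ecf_term \<Rightarrow> bool list" where
  "term_word (Var v) = nat_word 0 @ nat_word v"
| "term_word Const0 = nat_word 1"
| "term_word Const1 = nat_word 2"
| "term_word (Plus t u) = nat_word 3 @ term_word t @ term_word u"
| "term_word (Times t u) = nat_word 4 @ term_word t @ term_word u"
| "term_word (App e ts) =
    nat_word 5 @ rec_code_word e @ nat_word (length ts) @ concat (map term_word ts)"

primrec formula_word :: "ex_formula \<Rightarrow> bool list" where
  "formula_word (Less t u) = nat_word 0 @ term_word t @ term_word u"
| "formula_word (Equal t u) = nat_word 1 @ term_word t @ term_word u"
| "formula_word (Conj \<phi> \<psi>) = nat_word 2 @ formula_word \<phi> @ formula_word \<psi>"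
| "formula_word (Disj \<phi> \<psi>) = nat_word 3 @ formula_word \<phi> @ formula_word \<psi>"
| "formula_word (Exists v \<phi>) = nat_word 4 @ nat_word v @ formula_word \<phi>"

lemma nat_word_append_eq_iff [simp]: "nat_word m @ u = nat_word n @ v \<longleftrightarrow> m = n \<and> u = v"
proof (induction m arbitrary: n rule: nat_word.induct)
  case (1 m)
  have "m = n \<longleftrightarrow> odd m = odd n \<and> m div 2 = n div 2"
    by (metis odd_two_times_div_two_succ even_two_times_div_two)
  with 1 show ?case
    by (cases "m = 0"; cases "n = 0") (auto simp: nat_word.simps[of 0] nat_word.simps[of m] nat_word.simps[of n])
qed

lemma concat_words_cancel:
  assumes "\<And>x y u v. x \<in> set xs \<Longrightarrow> w x @ u = w y @ v \<Longrightarrow> x = y \<and> u = v"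
    and "length xs = length ys" and "concat (map w xs) @ u = concat (map w ys) @ v"
  shows "xs = ys \<and> u = v"
  using assms(2,1,3)
proof (induction xs ys rule: list_induct2)
  case (Cons x xs y ys)
  from Cons.prems(2) have
    "w x @ (concat (map w xs) @ u) = w y @ (concat (map w ys) @ v)" by simp
  from Cons.prems(1)[OF _ this]
  have "x = y" "concat (map w xs) @ u = concat (map w ys) @ v" by auto
  with Cons.IH Cons.prems(1) show ?case by (metis list.set_intros(2))
qed simp

lemma rec_code_word_cancel: "rec_code_word e @ u = rec_code_word e' @ v \<Longrightarrow> e = e' \<and> u = v"
proof (induction e arbitrary: e' u v)
  case (Comp f gs)
  show ?case
  proof (cases e')
    case (Comp f' gs')
    with Comp.prems have "f = f'" "length gs = length gs'"
      "concat (map rec_code_word gs) @ u = concat (map rec_code_word gs') @ v"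
      by (auto dest!: Comp.IH(1))
    moreover from this have "gs = gs' \<and> u = v"
      by (intro concat_words_cancel[of gs rec_code_word, OF Comp.IH(2)])
    ultimately show ?thesis using Comp by simp
  qed (use Comp.prems in auto)
next
  case (PrimRec f g)
  from PrimRec.prems show ?case by (cases e') (auto dest!: PrimRec.IH)
next
  case (Minim f)
  from Minim.prems show ?case by (cases e') (auto dest!: Minim.IH)
next
  case Zero
  then show ?case by (cases e') auto
next
  case Succ
  then show ?case by (cases e') auto
next
  case (Proj i)
  then show ?case by (cases e') auto
qed

lemma term_word_cancel: "term_word t @ u = term_word t' @ v \<Longrightarrow> t = t' \<and> u = v"
proof (induction t arbitrary: t' u v)
  case (App e ts)
  show ?case
  proof (cases t')
    case (App e' ts')
    with App.prems have "e = e'" "length ts = length ts'"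
      "concat (map term_word ts) @ u = concat (map term_word ts') @ v"
      by (auto dest!: rec_code_word_cancel)
    moreover from this have "ts = ts' \<and> u = v"
      by (intro concat_words_cancel[of ts term_word, OF App.IH])
    ultimately show ?thesis using App by simp
  qed (use App.prems in auto)
next
  case (Plus t1 t2)
  from Plus.prems show ?case by (cases t') (auto dest!: Plus.IH)
next
  case (Times t1 t2)
  from Times.prems show ?case by (cases t') (auto dest!: Times.IH)
next
  case (Var i)
  then show ?case by (cases t') auto
next
  case Const0
  then show ?case by (cases t') auto
next
  case Const1
  then show ?case by (cases t') auto
qed

lemma formula_word_cancel: "formula_word \<phi> @ u = formula_word \<psi> @ v \<Longrightarrow> \<phi> = \<psi> \<and> u = v"
proof (induction \<phi> arbitrary: \<psi> u v)
  case (Less t1 t2)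
  then show ?case by (cases \<psi>) (auto dest!: term_word_cancel)
next
  case (Equal t1 t2)
  then show ?case by (cases \<psi>) (auto dest!: term_word_cancel)
next
  case (Conj \<phi>1 \<phi>2)
  from Conj.prems show ?case by (cases \<psi>) (auto dest!: Conj.IH)
next
  case (Disj \<phi>1 \<phi>2)
  from Disj.prems show ?case by (cases \<psi>) (auto dest!: Disj.IH)
next
  case (Exists x \<phi>)
  from Exists.prems show ?case by (cases \<psi>) (auto dest!: Exists.IH)
qed

lemma inj_formula_word: "inj formula_word"
  using formula_word_cancel[where u = "[]" and v = "[]"] by (auto simp: inj_def)

definition ecf_less_sentence :: "ex_formula \<Rightarrow> bool" where
  "ecf_less_sentence \<phi> \<longleftrightarrow> over_ECF \<phi> \<and> equality_free \<phi> \<and> free_vars \<phi> = {}"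

text \<open>
  The instances are the sentences of the language, so their function symbols are codes of members of
  ECF; being such a code is not part of the question asked. (If words with an invalid code counted
  as no-instances, then the set of valid codes, which is not recursively enumerable, would reduce to
  the problem via the sentences \<open>\<exists>x. f(x) < f(x) + 1\<close>.)
\<close>

definition ETR_ECF_less :: "bool list set \<times> bool list set" where
  "ETR_ECF_less =
    (formula_word ` {\<phi>. ecf_less_sentence \<phi>},
     formula_word ` {\<phi>. ecf_less_sentence \<phi> \<and> holds_at \<phi> [] []})"

definition ExistsR_ECF_less :: "bool list set set" where
  "ExistsR_ECF_less = {L. polytime_reducible L ETR_ECF_less}"

end

theory Submission
  imports Defs
begin

text \<open>
  A strict inequality between terms is witnessed by finitely much information: evaluate both sides in
  interval arithmetic, using the programs of the function symbols, over a small enough rational box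
  of variable values; if the resulting intervals are strictly ordered, the inequality holds on the
  whole box, and by effective continuity every true strict inequality is found in this way. Hence a
  true existential formula without equality has a certificate in which an existential quantifier is
  witnessed by a rational interval. Certificates are derivations in a system of semidecidable rules,
  and derivability in such a system is semidecidable, since a derivation can be listed as a finite
  sequence in which the premises of an entry come after it. The same principle shows that the universal
  relation \<open>rec_computes\<close>, Turing machine runs and the parsing of formulae are semidecidable, so the
  certificates can be searched for uniformly in the formula, and through polynomial-time reductions.
\<close>

section \<open>Recursive functions and \<open>\<Sigma>\<^sub>1\<close> relations on natural numbers\<close>

text \<open>Equality is excluded because an equation can fail at points arbitrarily close to a
  solution, so no interval evaluation confirms it; a strict inequality between continuous terms
  persists near a point. This persistence also removes the reals from the search: a real witness has
  no finite code, but a rational interval around it can take its place, and a derivation then proves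
  the formula at every point of the box. Completeness by structural induction needs the stronger
  claim that all sufficiently fine boxes around a true point succeed, since different subformulae
  have to share one box. Validity of a function code is not semidecidable and is never tested: the
  rules run any program, and \<open>over_ECF\<close> enters only in the proofs of soundness and
  completeness. Functions on coded types are handled through their semidecidable graphs, so that
  explicit programs are composed only for basic arithmetic.\<close>

text \<open>
  The argument is an infinite environment, of which a program receives an arbitrary, sufficiently
  long prefix; this avoids all arity bookkeeping.
\<close>

definition recfun :: "((nat \<Rightarrow> nat) \<Rightarrow> nat) \<Rightarrow> bool" where
  "recfun f \<longleftrightarrow> (\<exists>k0. \<forall>k\<ge>k0. \<exists>e. \<forall>s. rec_computes e (map s [0..<k]) (f s))"

lemma recfun_arity:
  assumes "recfun f"
  obtains k0 where "\<And>k. k \<ge> k0 \<Longrightarrow> \<exists>e. \<forall>s. rec_computes e (map s [0..<k]) (f s)"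
  using assms unfolding recfun_def by blast

section \<open>Closure properties of recursive functions\<close>

lemma recfun_var: "recfun (\<lambda>s. s i)"
  unfolding recfun_def
proof (intro exI allI impI)
  fix k s assume "k \<ge> Suc i"
  then show "rec_computes (Proj i) (map s [0..<k]) (s i)"
    using rc_Proj[of i "map s [0..<k]"] by simp
qed

text \<open>Although \<open>g\<close> is an infinite family, \<open>f\<close> is run by a program of
  some fixed arity m, so only \<open>g 0\<close>, ..., \<open>g (m - 1)\<close> are composed with
  it, and their finitely many arity bounds have a maximum.\<close>

lemma recfun_subst:
  assumes f: "recfun f" and g: "\<And>i. recfun (g i)"
  shows "recfun (\<lambda>s. f (\<lambda>i. g i s))"
proof -
  obtain m where "\<And>k. k \<ge> m \<Longrightarrow> \<exists>e. \<forall>s. rec_computes e (map s [0..<k]) (f s)"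
    using recfun_arity[OF f] by metis
  then obtain e where e: "\<And>s. rec_computes e (map s [0..<m]) (f s)" by blast
  obtain k0 where k0: "\<And>i k. k \<ge> k0 i \<Longrightarrow> \<exists>e. \<forall>s. rec_computes e (map s [0..<k]) (g i s)"
    using g unfolding recfun_def by metis
  define k1 where "k1 = Max (insert 0 (k0 ` {..<m}))"
  have "\<exists>e. \<forall>s. rec_computes e (map s [0..<k]) (f (\<lambda>i. g i s))" if k: "k \<ge> k1" for k
  proof -
    have "k \<ge> k0 i" if "i < m" for i
    proof -
      have "k0 i \<le> k1" unfolding k1_def using that by (intro Max_ge) auto
      then show ?thesis using k by simp
    qed
    then have "\<forall>i. \<exists>e. i < m \<longrightarrow> (\<forall>s. rec_computes e (map s [0..<k]) (g i s))" using k0 by blast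
    then obtain h where h: "\<And>i s. i < m \<Longrightarrow> rec_computes (h i) (map s [0..<k]) (g i s)" by metis
    have "rec_computes (Comp e (map h [0..<m])) (map s [0..<k]) (f (\<lambda>i. g i s))" for s
      using e[of "\<lambda>i. g i s"] h
      by (intro rc_Comp[where ys = "map (\<lambda>i. g i s) [0..<m]"])
        (auto simp: list_all2_conv_all_nth)
    then show ?thesis by blast
  qed
  then show ?thesis unfolding recfun_def by blast
qed

lemma recfun_zero: "recfun (\<lambda>s. 0)"
  unfolding recfun_def using rc_Zero by blast

lemma recfun_Suc:
  assumes "recfun f"
  shows "recfun (\<lambda>s. Suc (f s))"
proof -
  obtain k0 where k0: "\<And>k. k \<ge> k0 \<Longrightarrow> \<exists>e. \<forall>s. rec_computes e (map s [0..<k]) (f s)"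
    using recfun_arity[OF assms] by metis
  have "\<exists>e. \<forall>s. rec_computes e (map s [0..<k]) (Suc (f s))" if k: "k \<ge> k0" for k
  proof -
    obtain e where e: "\<And>s. rec_computes e (map s [0..<k]) (f s)" using k0[OF k] by blast
    have "rec_computes (Comp Succ [e]) (map s [0..<k]) (Suc (f s))" for s
      using e[of s] rc_Succ[of "f s"] by (intro rc_Comp[where ys = "[f s]"]) auto
    then show ?thesis by blast
  qed
  then show ?thesis unfolding recfun_def by blast
qed

lemma recfun_const: "recfun (\<lambda>s. c)"
  by (induction c) (auto intro: recfun_zero recfun_Suc)

lemma recfun_case: "recfun f \<Longrightarrow> (\<And>j. recfun (g j)) \<Longrightarrow> recfun (\<lambda>s. case i of 0 \<Rightarrow> f s | Suc j \<Rightarrow> g j s)"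
  by (cases i) auto

lemma recfun_shift: "recfun f \<Longrightarrow> recfun (\<lambda>s. f (\<lambda>i. s (i + n)))"
  by (rule recfun_subst[of f "\<lambda>i s. s (i + n)"]) (simp_all add: recfun_var)

text \<open>\<open>PrimRec\<close> hands the counter and the previous value to its step program in
  front of the parameters; hence \<open>g\<close> reads its environment shifted by two
  places.\<close>

lemma recfun_rec_nat:
  assumes f: "recfun f" and g: "recfun (\<lambda>s. g (s 0) (s 1) (\<lambda>i. s (i + 2)))" and n: "recfun n"
  shows "recfun (\<lambda>s. rec_nat (f s) (\<lambda>i r. g i r s) (n s))"
proof -
  obtain kf where kf: "\<And>k. k \<ge> kf \<Longrightarrow> \<exists>e. \<forall>s. rec_computes e (map s [0..<k]) (f s)"
    using recfun_arity[OF f] by metis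
  obtain kg where kg: "\<And>k. k \<ge> kg \<Longrightarrow>
      \<exists>e. \<forall>s. rec_computes e (map s [0..<k]) (g (s 0) (s 1) (\<lambda>i. s (i + 2)))"
    using recfun_arity[OF g] by metis
  obtain kn where kn: "\<And>k. k \<ge> kn \<Longrightarrow> \<exists>e. \<forall>s. rec_computes e (map s [0..<k]) (n s)"
    using recfun_arity[OF n] by metis
  have "\<exists>e. \<forall>s. rec_computes e (map s [0..<k]) (rec_nat (f s) (\<lambda>i r. g i r s) (n s))"
    if k: "k \<ge> kf + kg + kn" for k
  proof -
    obtain ef where ef: "\<And>s. rec_computes ef (map s [0..<k]) (f s)"
      using kf[of k] k by auto
    obtain en where en: "\<And>s. rec_computes en (map s [0..<k]) (n s)"
      using kn[of k] k by auto
    obtain eg where eg: "\<And>s. rec_computes eg (map s [0..<k+2]) (g (s 0) (s 1) (\<lambda>i. s (i + 2)))"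
      using kg[of "k + 2"] k by auto
    have eg': "rec_computes eg (i # r # map s [0..<k]) (g i r s)" for i r s
    proof -
      have "map (case_nat i (case_nat r s)) [0..<k+2] = i # r # map s [0..<k]"
        by (simp add: map_upt_Suc del: upt_Suc)
      then show ?thesis using eg[of "case_nat i (case_nat r s)"] by simp
    qed
    have rec: "rec_computes (PrimRec ef eg) (m # map s [0..<k]) (rec_nat (f s) (\<lambda>i r. g i r s) m)"
      for m s
      by (induction m) (auto intro: rc_PrimRec_0 rc_PrimRec_Suc ef eg')
    \<comment> \<open>The recursion argument is the value computed by \<open>en\<close>; the
      projections pass the whole environment on as parameters.\<close>
    have "list_all2 (\<lambda>e y. rec_computes e (map s [0..<k]) y) (en # map Proj [0..<k])
        (n s # map s [0..<k])" for s
      using en rc_Proj[of _ "map s [0..<k]"]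
        by (auto simp: list_all2_conv_all_nth nth_Cons split: nat.split)
    then have "rec_computes (Comp (PrimRec ef eg) (en # map Proj [0..<k])) (map s [0..<k])
        (rec_nat (f s) (\<lambda>i r. g i r s) (n s))" for s
      using rec by (rule rc_Comp)
    then show ?thesis by blast
  qed
  then show ?thesis unfolding recfun_def by blast
qed

lemma recfun_add:
  assumes "recfun f" "recfun g" shows "recfun (\<lambda>s. f s + g s)"
proof -
  have "rec_nat a (\<lambda>i r. Suc r) b = a + b" for a b by (induction b) auto
  then show ?thesis using recfun_rec_nat[of f "\<lambda>i r s. Suc r" g] assms
    by (simp add: recfun_Suc recfun_var)
qed

lemma recfun_mult:
  assumes "recfun f" "recfun g" shows "recfun (\<lambda>s. f s * g s)"
proof -
  have "rec_nat 0 (\<lambda>i r. r + a) b = a * b" for a b :: nat by (induction b) auto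
  then show ?thesis using recfun_rec_nat[of "\<lambda>s. 0" "\<lambda>i r s. r + f s" g] assms
    by (simp add: recfun_add recfun_var recfun_zero recfun_shift[of f 2, simplified])
qed

lemma recfun_diff:
  assumes "recfun f" "recfun g" shows "recfun (\<lambda>s. f s - g s)"
proof -
  have pred: "rec_nat 0 (\<lambda>i r. i) b = b - 1" for b :: nat by (cases b) auto
  then have p: "recfun h \<Longrightarrow> recfun (\<lambda>s. h s - 1)" for h
    using recfun_rec_nat[of "\<lambda>s. 0" "\<lambda>i r s. i" h] by (simp add: recfun_var recfun_zero)
  have "rec_nat a (\<lambda>i r. r - 1) b = a - b" for a b :: nat by (induction b) auto
  then show ?thesis using recfun_rec_nat[of f "\<lambda>i r s. r - 1" g] assms p[OF recfun_var] by simp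
qed

text \<open>Bounded sums take the place of bounded search: pairing, list decoding and the bounded
  quantifiers below are all expressed through them.\<close>

lemma recfun_sum:
  assumes f: "recfun (\<lambda>s. f (s 0) (\<lambda>i. s (Suc i)))" and n: "recfun n"
  shows "recfun (\<lambda>s. \<Sum>i<n s. f i s)"
proof -
  have "recfun (\<lambda>s. f (s 0) (\<lambda>i. s (i + 2)))"
    using recfun_subst[OF f, of "\<lambda>i s. case i of 0 \<Rightarrow> s 0 | Suc j \<Rightarrow> s (j + 2)"]
    by (simp add: recfun_case recfun_var)
  then have "recfun (\<lambda>s. rec_nat 0 (\<lambda>i r. r + f i s) (n s))"
    by (intro recfun_rec_nat recfun_add recfun_var recfun_zero n)
  moreover have "rec_nat 0 (\<lambda>i r. r + g i) m = (\<Sum>i<m. g i)" for g :: "nat \<Rightarrow> nat" and m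
    by (induction m) auto
  ultimately show ?thesis by simp
qed

lemma recfun_prod_encode:
  assumes "recfun f" "recfun g" shows "recfun (\<lambda>s. prod_encode (f s, g s))"
proof -
  have "triangle n = (\<Sum>i<n. Suc i)" for n by (induction n) auto
  then have *: "prod_encode (a, b) = (\<Sum>i<a+b. Suc i) + a" for a b
    by (simp add: prod_encode_def)
  show ?thesis unfolding * by (intro recfun_add recfun_sum recfun_Suc recfun_var assms)
qed

section \<open>Decoding of lists\<close>

definition code_tl :: "nat \<Rightarrow> nat" where
  "code_tl x = list_encode (tl (list_decode x))"

text \<open>A nonempty list with head a and tail code b has code
  \<open>Suc (prod_encode (a, b))\<close>. The two truncated differences add up to 0 exactly for
  equality, so the double sum retains b for the only pair that yields x. Both components are below
  x, and the empty sum for x = 0 agrees with \<open>tl [] = []\<close>.\<close>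

lemma code_tl_sum:
  "code_tl x = (\<Sum>a<x. \<Sum>b<x. b * (1 - ((x - Suc (prod_encode (a, b))) + (Suc (prod_encode (a, b)) - x))))"
  (is "_ = (\<Sum>a<x. \<Sum>b<x. ?t a b)")
proof (cases x)
  case 0
  then show ?thesis by (simp add: code_tl_def)
next
  case (Suc n)
  obtain u v where uv: "prod_decode n = (u, v)" by (cases "prod_decode n")
  then have n: "n = prod_encode (u, v)" by (metis prod_decode_inverse)
  have lt: "u < x" "v < x" using le_prod_encode_1[of u v] le_prod_encode_2[of v u] Suc n by auto
  have t: "?t a b = (if b = v then if a = u then v else 0 else 0)" for a b
  proof -
    have "x = Suc (prod_encode (a, b)) \<longleftrightarrow> a = u \<and> b = v" using Suc n by auto
    then show ?thesis by (cases "x = Suc (prod_encode (a, b))") auto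
  qed
  have "(\<Sum>a<x. \<Sum>b<x. ?t a b) = v" unfolding t using lt by (simp add: sum.delta)
  moreover have "code_tl x = v" using Suc uv by (simp add: code_tl_def)
  ultimately show ?thesis by simp
qed

lemma recfun_code_tl:
  assumes "recfun f" shows "recfun (\<lambda>s. code_tl (f s))"
proof -
  have "recfun (\<lambda>s. code_tl (s 0))"
    unfolding code_tl_sum
    by (intro recfun_sum recfun_mult recfun_diff recfun_add recfun_Suc recfun_prod_encode recfun_var
      recfun_const)
  from recfun_subst[OF this, of "\<lambda>_. f"] show ?thesis using assms by simp
qed

text \<open>An entry of a list is the head of a suffix, so membership and quantification over the
  entries are later reduced to \<open>drop\<close>.\<close>

definition code_drop :: "nat \<Rightarrow> nat \<Rightarrow> nat" where
  "code_drop n x = rec_nat x (\<lambda>i r. code_tl r) n"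

lemma recfun_code_drop: "recfun f \<Longrightarrow> recfun g \<Longrightarrow> recfun (\<lambda>s. code_drop (f s) (g s))"
  unfolding code_drop_def by (intro recfun_rec_nat recfun_code_tl recfun_var)

lemma code_drop: "code_drop n (list_encode xs) = list_encode (drop n xs)"
  unfolding code_drop_def by (induction n) (auto simp: code_tl_def drop_Suc tl_drop)

lemmas recfun_rules =
  recfun_var recfun_const recfun_Suc recfun_add recfun_diff recfun_mult recfun_sum
  recfun_prod_encode recfun_code_drop

section \<open>Closure properties of recursively enumerable relations\<close>

definition sigma1 :: "((nat \<Rightarrow> nat) \<Rightarrow> bool) \<Rightarrow> bool" where
  "sigma1 P \<longleftrightarrow> (\<exists>R. recfun R \<and> (\<forall>s. P s \<longleftrightarrow> (\<exists>y. R (case_nat y s) = 0)))"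

text \<open>The value 0 stands for truth, which makes addition a conjunction and multiplication a
  disjunction. Here \<open>1 - r y\<close> is the indicator of a zero of r, so the sum counts the
  zeros below b.\<close>

lemma bounded_search: "1 - (\<Sum>y<b. 1 - r y) = 0 \<longleftrightarrow> (\<exists>y<b. r y = 0)" for r :: "nat \<Rightarrow> nat"
proof -
  have "(\<Sum>y<b. 1 - r y) = 0 \<longleftrightarrow> (\<forall>y<b. r y \<noteq> 0)" by (auto simp: Suc_le_eq)
  moreover have "1 - x = 0 \<longleftrightarrow> x \<noteq> 0" for x :: nat by linarith
  ultimately show ?thesis by blast
qed

text \<open>The witness is replaced by an upper bound for some witness. Bounds can be enlarged
  freely, so several witnesses can be merged into one number by a sum or a maximum.\<close>

lemma sigma1E:
  assumes "sigma1 P"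
  obtains R where "recfun R" "\<And>s. P s \<longleftrightarrow> (\<exists>b. R (case_nat b s) = 0)"
    "\<And>b b' s. R (case_nat b s) = 0 \<Longrightarrow> b \<le> b' \<Longrightarrow> R (case_nat b' s) = 0"
proof -
  obtain R where R: "recfun R" "\<And>s. P s \<longleftrightarrow> (\<exists>y. R (case_nat y s) = 0)"
    using assms unfolding sigma1_def by blast
  define R' where "R' s = 1 - (\<Sum>y<s 0. 1 - R (case_nat y (\<lambda>i. s (Suc i))))" for s
  have R': "R' (case_nat b s) = 0 \<longleftrightarrow> (\<exists>y<b. R (case_nat y s) = 0)" for b s
    unfolding R'_def using bounded_search[of "\<lambda>y. R (case_nat y s)" b] by simp
  have "recfun (\<lambda>s. R (case_nat (s 0) (\<lambda>i. s (Suc (Suc i)))))"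
    using recfun_subst[OF R(1), of "\<lambda>i s. case i of 0 \<Rightarrow> s 0 | Suc j \<Rightarrow> s (Suc (Suc j))"]
    by (simp add: recfun_case recfun_var)
  then have "recfun R'"
    unfolding R'_def by (intro recfun_rules)
  moreover have "P s \<longleftrightarrow> (\<exists>b. R' (case_nat b s) = 0)" for s
    unfolding R' R(2) by auto
  ultimately show thesis using R' by (intro that[of R']) (auto intro: less_le_trans)
qed

lemma sigma1_eq:
  assumes "recfun f" "recfun g" shows "sigma1 (\<lambda>s. f s = g s)"
  unfolding sigma1_def
proof (intro exI conjI)
  show "recfun (\<lambda>s. (f (\<lambda>i. s (i + 1)) - g (\<lambda>i. s (i + 1))) + (g (\<lambda>i. s (i + 1)) - f (\<lambda>i. s (i + 1))))"
    using assms by (intro recfun_add recfun_diff recfun_shift)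
qed auto

lemma sigma1_conj:
  assumes "sigma1 P" "sigma1 Q" shows "sigma1 (\<lambda>s. P s \<and> Q s)"
proof -
  obtain R where R: "recfun R" "\<And>s. P s \<longleftrightarrow> (\<exists>b. R (case_nat b s) = 0)"
    "\<And>b b' s. R (case_nat b s) = 0 \<Longrightarrow> b \<le> b' \<Longrightarrow> R (case_nat b' s) = 0"
    using assms(1) by (rule sigma1E) blast
  obtain S where S: "recfun S" "\<And>s. Q s \<longleftrightarrow> (\<exists>b. S (case_nat b s) = 0)"
    "\<And>b b' s. S (case_nat b s) = 0 \<Longrightarrow> b \<le> b' \<Longrightarrow> S (case_nat b' s) = 0"
    using assms(2) by (rule sigma1E) blast
  show ?thesis
    unfolding sigma1_def
  proof (intro exI conjI allI)
    show "recfun (\<lambda>s. R s + S s)" using R S by (intro recfun_add)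
    fix s show "P s \<and> Q s \<longleftrightarrow> (\<exists>y. R (case_nat y s) + S (case_nat y s) = 0)"
    proof
      assume "P s \<and> Q s"
      then obtain a b where "R (case_nat a s) = 0" "S (case_nat b s) = 0"
        unfolding R(2) S(2) by blast
      then have "R (case_nat (a + b) s) = 0" "S (case_nat (a + b) s) = 0"
        using R(3) S(3) le_add1 le_add2 by blast+
      then show "\<exists>y. R (case_nat y s) + S (case_nat y s) = 0" by (intro exI[of _ "a + b"]) simp
    qed (auto simp: R(2) S(2))
  qed
qed

lemma sigma1_disj:
  assumes "sigma1 P" "sigma1 Q" shows "sigma1 (\<lambda>s. P s \<or> Q s)"
proof -
  obtain R where R: "recfun R" "\<And>s. P s \<longleftrightarrow> (\<exists>b. R (case_nat b s) = 0)"
    using assms(1) unfolding sigma1_def by blast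
  obtain S where S: "recfun S" "\<And>s. Q s \<longleftrightarrow> (\<exists>b. S (case_nat b s) = 0)"
    using assms(2) unfolding sigma1_def by blast
  show ?thesis
    unfolding sigma1_def
  proof (intro exI conjI allI)
    show "recfun (\<lambda>s. R s * S s)" using R S by (intro recfun_mult)
  qed (auto simp: R S)
qed

text \<open>In a bounded sum the summation index is the first coordinate, whereas \<open>R\<close>
  expects its search bound there.\<close>

lemma recfun_swap:
  assumes "recfun R"
  shows "recfun (\<lambda>s. R (case_nat (s (Suc 0)) (case_nat (s 0) (\<lambda>i. s (Suc (Suc i))))))"
  using recfun_subst[OF assms, of "\<lambda>i s. case i of 0 \<Rightarrow> s (Suc 0)
    | Suc j \<Rightarrow> (case j of 0 \<Rightarrow> s 0 | Suc l \<Rightarrow> s (Suc (Suc l)))"]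
  by (simp add: recfun_case recfun_var)

text \<open>Two unbounded quantifiers become one: a single b bounds both the quantified y and the
  witness for \<open>P y\<close>.\<close>

lemma sigma1_ex:
  assumes "sigma1 (\<lambda>s. P (s 0) (\<lambda>i. s (Suc i)))" shows "sigma1 (\<lambda>s. \<exists>y. P y s)"
proof -
  obtain R where R: "recfun R" "\<And>s. P (s 0) (\<lambda>i. s (Suc i)) \<longleftrightarrow> (\<exists>b. R (case_nat b s) = 0)"
    "\<And>b b' s. R (case_nat b s) = 0 \<Longrightarrow> b \<le> b' \<Longrightarrow> R (case_nat b' s) = 0"
    using assms by (rule sigma1E) blast
  have P: "P y s \<longleftrightarrow> (\<exists>b. R (case_nat b (case_nat y s)) = 0)" for y s
    using R(2)[of "case_nat y s"] by simp
  define R' where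
    "R' s = 1 - (\<Sum>y<s 0. 1 - R (case_nat (s 0) (case_nat y (\<lambda>i. s (Suc i)))))" for s
  have R': "R' (case_nat b s) = 0 \<longleftrightarrow> (\<exists>y<b. R (case_nat b (case_nat y s)) = 0)" for b s
    unfolding R'_def using bounded_search[of "\<lambda>y. R (case_nat b (case_nat y s))" b] by simp
  show ?thesis
    unfolding sigma1_def
  proof (intro exI conjI allI)
    show "recfun R'"
      unfolding R'_def by (intro recfun_rules recfun_swap R(1))
    fix s show "(\<exists>y. P y s) \<longleftrightarrow> (\<exists>b. R' (case_nat b s) = 0)"
    proof
      assume "\<exists>y. P y s"
      then obtain y b where "R (case_nat b (case_nat y s)) = 0" unfolding P by blast
      then have "R (case_nat (max b (Suc y)) (case_nat y s)) = 0" by (rule R(3)) simp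
      then show "\<exists>b. R' (case_nat b s) = 0"
        unfolding R' by (intro exI[of _ "max b (Suc y)"] exI[of _ y]) auto
    qed (auto simp: R' P)
  qed
qed

text \<open>This is the collection principle: the finitely many indices have witnesses with a common
  bound, for which their sum serves.\<close>

lemma sigma1_all:
  assumes P: "sigma1 (\<lambda>s. P (s 0) (\<lambda>i. s (Suc i)))" and n: "recfun n"
  shows "sigma1 (\<lambda>s. \<forall>i<n s. P i s)"
proof -
  obtain R where R: "recfun R" "\<And>s. P (s 0) (\<lambda>i. s (Suc i)) \<longleftrightarrow> (\<exists>b. R (case_nat b s) = 0)"
    "\<And>b b' s. R (case_nat b s) = 0 \<Longrightarrow> b \<le> b' \<Longrightarrow> R (case_nat b' s) = 0"
    using assms(1) by (rule sigma1E) blast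
  have P: "P y s \<longleftrightarrow> (\<exists>b. R (case_nat b (case_nat y s)) = 0)" for y s
    using R(2)[of "case_nat y s"] by simp
  show ?thesis
    unfolding sigma1_def
  proof (intro exI conjI allI)
    show "recfun (\<lambda>s. \<Sum>i<n (\<lambda>i. s (i + 1)). R (case_nat (s 0) (case_nat i (\<lambda>i. s (Suc i)))))"
      by (intro recfun_sum recfun_swap R(1) recfun_shift n)
    fix s
    show "(\<forall>i<n s. P i s) \<longleftrightarrow> (\<exists>b. (\<Sum>i<n (\<lambda>i. (case_nat b s) (i + 1)).
        R (case_nat ((case_nat b s) 0) (case_nat i (\<lambda>i. (case_nat b s) (Suc i))))) = 0)"
    proof
      assume "\<forall>i<n s. P i s"
      then obtain b where b: "\<And>i. i < n s \<Longrightarrow> R (case_nat (b i) (case_nat i s)) = 0"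
        unfolding P by metis
      have "R (case_nat (\<Sum>i<n s. b i) (case_nat i s)) = 0" if "i < n s" for i
        by (rule R(3)[OF b[OF that]]) (use that in \<open>auto intro: member_le_sum\<close>)
      then show "\<exists>b. (\<Sum>i<n (\<lambda>i. (case_nat b s) (i + 1)).
        R (case_nat ((case_nat b s) 0) (case_nat i (\<lambda>i. (case_nat b s) (Suc i))))) = 0"
        by (intro exI[of _ "\<Sum>i<n s. b i"]) simp
    qed (auto simp: P)
  qed
qed

lemmas sigma1_rules = sigma1_eq sigma1_conj sigma1_disj sigma1_ex sigma1_all recfun_rules

lemma sigma1_subst:
  assumes "sigma1 P" "\<And>i. recfun (g i)"
  shows "sigma1 (\<lambda>s. P (\<lambda>i. g i s))"
proof -
  obtain R where R: "recfun R" "\<And>s. P s \<longleftrightarrow> (\<exists>y. R (case_nat y s) = 0)"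
    using assms(1) unfolding sigma1_def by blast
  have "recfun (\<lambda>s. R (case_nat (s 0) (\<lambda>i. g i (\<lambda>j. s (Suc j)))))"
    using recfun_subst[OF R(1), of "\<lambda>i s. case i of 0 \<Rightarrow> s 0 | Suc j \<Rightarrow> g j (\<lambda>l. s (Suc l))"]
      recfun_shift[OF assms(2), where n = 1]
    by (simp add: recfun_case recfun_var)
  then show ?thesis unfolding sigma1_def R(2)
    by (intro exI[of _ "\<lambda>s. R (case_nat (s 0) (\<lambda>i. g i (\<lambda>j. s (Suc j))))"]) simp
qed

lemma sigma1_subst1: "sigma1 (\<lambda>s. Q (s 0)) \<Longrightarrow> recfun f \<Longrightarrow> sigma1 (\<lambda>s. Q (f s))"
  using sigma1_subst[of "\<lambda>s. Q (s 0)" "\<lambda>_. f"] by simp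

lemma sigma1_subst2: "sigma1 (\<lambda>s. Q (s 0) (s 1)) \<Longrightarrow> recfun f \<Longrightarrow> recfun g \<Longrightarrow> sigma1 (\<lambda>s. Q (f s) (g s))"
  using sigma1_subst[of "\<lambda>s. Q (s 0) (s 1)" "\<lambda>i. if i = 0 then f else g"] by simp

text \<open>The set is the domain of the minimization program that searches for a witness.\<close>

lemma sigma1_re_nat:
  assumes "sigma1 (\<lambda>s. Q (s 0))"
  shows "re_nat {x. Q x}"
proof -
  obtain R where R: "recfun R" "\<And>s. Q (s 0) \<longleftrightarrow> (\<exists>y. R (case_nat y s) = 0)"
    using assms unfolding sigma1_def by blast
  obtain k where "\<And>m. m \<ge> k \<Longrightarrow> \<exists>e. \<forall>s. rec_computes e (map s [0..<m]) (R s)"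
    using recfun_arity[OF R(1)] by metis
  then obtain e where e: "\<And>s. rec_computes e (map s [0..<k]) (R s)" by blast
  define s where "s n x = case_nat n (case_nat x (\<lambda>_::nat. 0::nat))" for n x :: nat
  \<comment> \<open>The program \<open>e\<close> expects a prefix of length k of the environment n,
    x, 0, 0, ...; all entries after the first two are supplied by \<open>Zero\<close>.\<close>
  define e' where "e' = Comp e (map (\<lambda>i. if i < 2 then Proj i else Zero) [0..<k])"
  have e': "rec_computes e' [n, x] (R (s n x))" for n x
    unfolding e'_def
  proof (rule rc_Comp)
    show "list_all2 (\<lambda>g y. rec_computes g [n, x] y)
        (map (\<lambda>i. if i < 2 then Proj i else Zero) [0..<k]) (map (s n x) [0..<k])"
      using rc_Proj[of 0 "[n, x]"] rc_Proj[of 1 "[n, x]"]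
      by (auto simp: list_all2_conv_all_nth s_def less_Suc_eq numeral_2_eq_2 rc_Zero split: nat.splits)
  qed (rule e)
  have Q: "Q x \<longleftrightarrow> (\<exists>n. R (s n x) = 0)" for x
    using R(2)[of "case_nat x (\<lambda>_. 0)"] by (simp add: s_def)
  have "Q x \<longleftrightarrow> (\<exists>y. rec_computes (Minim e') [x] y)" for x
  proof
    assume "Q x"
    then obtain m where m: "R (s m x) = 0" unfolding Q by blast
    \<comment> \<open>The least zero is taken because \<open>rc_Minim\<close> demands positive
      values at all smaller arguments.\<close>
    define n where "n = (LEAST n. R (s n x) = 0)"
    have n: "R (s n x) = 0" unfolding n_def using m by (rule LeastI)
    have less: "R (s i x) \<noteq> 0" if "i < n" for i
      using that unfolding n_def by (rule not_less_Least)
    have "rec_computes (Minim e') [x] n"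
    proof (rule rc_Minim)
      show "rec_computes e' [n, x] 0" using e'[of n x] n by simp
      show "\<forall>i<n. \<exists>m. rec_computes e' [i, x] (Suc m)"
      proof (intro allI impI)
        fix i assume "i < n"
        then obtain m where "R (s i x) = Suc m" using less not0_implies_Suc by blast
        then show "\<exists>m. rec_computes e' [i, x] (Suc m)" using e'[of i x] by auto
      qed
    qed
    then show "\<exists>y. rec_computes (Minim e') [x] y" ..
  next
    assume "\<exists>y. rec_computes (Minim e') [x] y"
    then obtain n where "rec_computes e' [n, x] 0" by (auto elim: rec_computes.cases)
    then have "R (s n x) = 0" using e'[of n x] rec_computes_unique by blast
    then show "Q x" unfolding Q by blast
  qed
  then show ?thesis unfolding re_nat_def by blast
qed

section \<open>Semidecidable predicates on coded types\<close>

named_theorems semidec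

text \<open>
  The range has to be \<open>\<Sigma>\<^sub>1\<close>: a quantifier over the type is one over the natural numbers that are codes.
\<close>

class enc =
  fixes enc :: "'a \<Rightarrow> nat"
  assumes enc_inject: "enc x = enc y \<Longrightarrow> x = y"
    and sigma1_range: "sigma1 (\<lambda>s. \<exists>x. s 0 = enc x)"

lemma enc_eq_iff [simp]: "enc x = enc y \<longleftrightarrow> x = y"
  using enc_inject by auto

definition coded :: "'a::enc itself \<Rightarrow> nat \<Rightarrow> bool" where
  "coded T n \<longleftrightarrow> (\<exists>x::'a. n = enc x)"

lemma sigma1_coded: "recfun f \<Longrightarrow> sigma1 (\<lambda>s. coded T (f s))"
  unfolding coded_def by (rule sigma1_subst1[OF sigma1_range])

instantiation nat :: enc
begin
definition enc_nat :: "nat \<Rightarrow> nat" where [simp]: "enc_nat n = n"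
instance
proof
  show "sigma1 (\<lambda>s. \<exists>x::nat. s 0 = enc x)" using sigma1_eq[OF recfun_var recfun_var, of 0 0] by simp
qed simp
end

instantiation prod :: (enc, enc) enc
begin
definition enc_prod :: "'a \<times> 'b \<Rightarrow> nat" where "enc_prod p = prod_encode (enc (fst p), enc (snd p))"
instance
proof
  have "sigma1 (\<lambda>s. \<exists>m n. s 0 = prod_encode (m, n) \<and> coded TYPE('a) m \<and> coded TYPE('b) n)"
    by (intro sigma1_rules sigma1_coded)
  then show "sigma1 (\<lambda>s. \<exists>x::'a \<times> 'b. s 0 = enc x)"
    by (rule back_subst[of sigma1]) (auto simp: coded_def enc_prod_def fun_eq_iff)
qed (simp add: enc_prod_def prod_eq_iff)
end

lemma enc_Pair: "enc (x, y) = prod_encode (enc x, enc y)" by (simp add: enc_prod_def)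

text \<open>Allows the code of a list itself to bound a quantifier over the positions in the
  list.\<close>

lemma length_le_list_encode: "length xs \<le> list_encode xs"
proof (induction xs)
  case (Cons x xs)
  then show ?case using le_prod_encode_2[of "list_encode xs" x] by simp
qed simp

lemma list_encode_eq_Suc:
  "list_encode xs = Suc (prod_encode (h, t)) \<longleftrightarrow> xs = h # list_decode t"
  by (cases xs) (auto simp: list_encode_eq[symmetric])

text \<open>This coding, and those of \<open>bool\<close> and \<open>rat\<close> below, agree with
  the ones in \<open>Sigma01\<close> and \<open>re_rat_tuples\<close>, so that the final results
  need no recoding.\<close>

instantiation list :: (enc) enc
begin
definition enc_list :: "'a list \<Rightarrow> nat" where "enc_list xs = list_encode (map enc xs)"
instance
proof
  fix xs ys :: "'a list"
  show "enc xs = enc ys \<Longrightarrow> xs = ys"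
    by (simp add: enc_list_def list_encode_eq inj_map_eq_map inj_def)
next
  let ?P = "\<lambda>n. \<forall>i<n. code_drop i n = 0 \<or> (\<exists>h t. code_drop i n = Suc (prod_encode (h, t)) \<and> coded TYPE('a) h)"
  have "sigma1 (\<lambda>s. ?P (s 0))"
    by (intro sigma1_rules sigma1_coded)
  moreover have "?P n \<longleftrightarrow> (\<exists>x::'a list. n = enc x)" for n
  proof -
    define xs where "xs = list_decode n"
    have n: "n = list_encode xs" by (simp add: xs_def)
    have "?P n \<longleftrightarrow> (\<forall>i<n. drop i xs = [] \<or> (\<exists>h t. drop i xs = h # t \<and> coded TYPE('a) h))"
      unfolding n code_drop list_encode_eq_Suc using list_encode_eq[of _ "[]"]
      by (simp, metis list_encode_inverse)
    also have "\<dots> \<longleftrightarrow> (\<forall>h\<in>set xs. coded TYPE('a) h)"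
    proof
      assume L: "\<forall>i<n. drop i xs = [] \<or> (\<exists>h t. drop i xs = h # t \<and> coded TYPE('a) h)"
      show "\<forall>h\<in>set xs. coded TYPE('a) h"
      proof
        fix h assume "h \<in> set xs"
        then obtain i where i: "i < length xs" "h = xs ! i" by (auto simp: in_set_conv_nth)
        moreover have "i < n" using i(1) length_le_list_encode[of xs] n by simp
        ultimately show "coded TYPE('a) h" using L Cons_nth_drop_Suc[OF i(1)] by fastforce
      qed
    next
      assume R: "\<forall>h\<in>set xs. coded TYPE('a) h"
      show "\<forall>i<n. drop i xs = [] \<or> (\<exists>h t. drop i xs = h # t \<and> coded TYPE('a) h)"
      proof (intro allI impI)
        fix i
        show "drop i xs = [] \<or> (\<exists>h t. drop i xs = h # t \<and> coded TYPE('a) h)"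
          using R set_drop_subset[of i xs] by (cases "drop i xs") auto
      qed
    qed
    also have "\<dots> \<longleftrightarrow> xs \<in> lists (range (enc :: 'a \<Rightarrow> nat))" by (auto simp: coded_def in_lists_conv_set)
    also have "\<dots> \<longleftrightarrow> (\<exists>ys::'a list. xs = map enc ys)" by (auto simp: lists_image)
    also have "\<dots> \<longleftrightarrow> (\<exists>x::'a list. n = enc x)"
      by (simp add: enc_list_def n list_encode_eq)
    finally show ?thesis .
  qed
  ultimately show "sigma1 (\<lambda>s. \<exists>x::'a list. s 0 = enc x)" by simp
qed
end

lemma enc_Cons: "enc (x # xs) = Suc (prod_encode (enc x, enc xs))" by (simp add: enc_list_def)

text \<open>\<open>Q\<close> has to be right on codes only and may be arbitrary elsewhere. Therefore
  every quantifier over a coded type and every intermediate value with a coded type is guarded by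
  \<open>coded\<close>.\<close>

definition semidecidable :: "('a::enc \<Rightarrow> bool) \<Rightarrow> bool" where
  "semidecidable P \<longleftrightarrow> (\<exists>Q. sigma1 (\<lambda>s. Q (s 0)) \<and> (\<forall>x. P x \<longleftrightarrow> Q (enc x)))"

text \<open>Only the graph is required to be recursively enumerable; as HOL functions are total, a
  search through the graph finds each value. Compositions can then be formed logically, without
  building programs.\<close>

definition computable :: "('a::enc \<Rightarrow> 'b::enc) \<Rightarrow> bool" where
  "computable f \<longleftrightarrow> (\<exists>G. sigma1 (\<lambda>s. G (s 0) (s 1)) \<and> (\<forall>x y. y = f x \<longleftrightarrow> G (enc x) (enc y)))"

lemma semidecidableI:
  "sigma1 (\<lambda>s. Q (s 0)) \<Longrightarrow> (\<And>x. P x \<longleftrightarrow> Q (enc x)) \<Longrightarrow> semidecidable P"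
  unfolding semidecidable_def by blast

lemma computableI:
  "sigma1 (\<lambda>s. G (s 0) (s 1)) \<Longrightarrow> (\<And>x y. y = f x \<longleftrightarrow> G (enc x) (enc y)) \<Longrightarrow> computable f"
  unfolding computable_def by blast

lemma semidec_id: "computable (\<lambda>x. x)"
  by (rule computableI[where G = "\<lambda>z y. z = y"]) (auto intro: sigma1_eq recfun_var)

lemma semidec_const [semidec]: "computable (\<lambda>x. c)"
  by (rule computableI[where G = "\<lambda>z y. y = enc c"]) (auto intro: sigma1_eq recfun_var recfun_const)

lemma computable_comp:
  fixes f :: "'a::enc \<Rightarrow> 'b::enc" and g :: "'b \<Rightarrow> 'c::enc"
  assumes "computable g" "computable f"
  shows "computable (\<lambda>x. g (f x))"
proof -
  obtain G where G: "sigma1 (\<lambda>s. G (s 0) (s 1))" "\<And>x y. y = g x \<longleftrightarrow> G (enc x) (enc y)"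
    using assms(1) unfolding computable_def by blast
  obtain F where F: "sigma1 (\<lambda>s. F (s 0) (s 1))" "\<And>x y. y = f x \<longleftrightarrow> F (enc x) (enc y)"
    using assms(2) unfolding computable_def by blast
  show ?thesis
  proof (rule computableI)
    show "sigma1 (\<lambda>s. \<exists>m. coded TYPE('b) m \<and> F (s 0) m \<and> G m (s 1))"
      by (intro sigma1_ex sigma1_conj sigma1_coded sigma1_subst2[OF F(1)] sigma1_subst2[OF G(1)]
        recfun_var)
  qed (auto simp: coded_def F(2)[symmetric] G(2)[symmetric])
qed

lemma semidecidable_comp:
  fixes f :: "'a::enc \<Rightarrow> 'b::enc"
  assumes "semidecidable P" "computable f"
  shows "semidecidable (\<lambda>x. P (f x))"
proof -
  obtain Q where Q: "sigma1 (\<lambda>s. Q (s 0))" "\<And>x. P x \<longleftrightarrow> Q (enc x)"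
    using assms(1) unfolding semidecidable_def by blast
  obtain F where F: "sigma1 (\<lambda>s. F (s 0) (s 1))" "\<And>x y. y = f x \<longleftrightarrow> F (enc x) (enc y)"
    using assms(2) unfolding computable_def by blast
  show ?thesis
  proof (rule semidecidableI)
    show "sigma1 (\<lambda>s. \<exists>m. coded TYPE('b) m \<and> F (s 0) m \<and> Q m)"
      by (intro sigma1_ex sigma1_conj sigma1_coded sigma1_subst2[OF F(1)] sigma1_subst1[OF Q(1)]
        recfun_var)
  qed (auto simp: coded_def F(2)[symmetric] Q(2)[symmetric])
qed

lemma computable_fst: "computable fst"
proof (rule computableI)
  show "sigma1 (\<lambda>s. \<exists>b. s 0 = prod_encode (s 1, b))" by (intro sigma1_rules)
qed (auto simp: enc_prod_def)

lemma computable_snd: "computable snd"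
proof (rule computableI)
  show "sigma1 (\<lambda>s. \<exists>a. s 0 = prod_encode (a, s 1))" by (intro sigma1_rules)
qed (auto simp: enc_prod_def)

text \<open>In this composed form, with a context variable under the abstraction, the rules let
  \<open>intro semidec\<close> descend along the syntax of an expression; a quantifier extends the
  context by pairing.\<close>

lemma semidec_fst [semidec]: "computable f \<Longrightarrow> computable (\<lambda>x. fst (f x))"
  by (rule computable_comp[OF computable_fst])

lemma semidec_snd [semidec]: "computable f \<Longrightarrow> computable (\<lambda>x. snd (f x))"
  by (rule computable_comp[OF computable_snd])

lemma semidec_Pair [semidec]:
  assumes "computable f" "computable g"
  shows "computable (\<lambda>x. (f x, g x))"
proof -
  obtain F where F: "sigma1 (\<lambda>s. F (s 0) (s 1))" "\<And>x y. y = f x \<longleftrightarrow> F (enc x) (enc y)"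
    using assms(1) unfolding computable_def by blast
  obtain G where G: "sigma1 (\<lambda>s. G (s 0) (s 1))" "\<And>x y. y = g x \<longleftrightarrow> G (enc x) (enc y)"
    using assms(2) unfolding computable_def by blast
  show ?thesis
  proof (rule computableI)
    show "sigma1 (\<lambda>s. \<exists>a b. s 1 = prod_encode (a, b) \<and> F (s 0) a \<and> G (s 0) b)"
      by (intro sigma1_ex sigma1_conj sigma1_subst2[OF F(1)] sigma1_subst2[OF G(1)] sigma1_eq
        recfun_prod_encode recfun_var)
  qed (auto simp: enc_prod_def F(2)[symmetric] G(2)[symmetric] prod_eq_iff)
qed

lemma computable_comp2:
  "computable (\<lambda>p. h (fst p) (snd p)) \<Longrightarrow> computable f \<Longrightarrow> computable g \<Longrightarrow>
    computable (\<lambda>x. h (f x) (g x))"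
  using computable_comp[OF _ semidec_Pair, of "\<lambda>p. h (fst p) (snd p)" f g] by simp

lemma semidecidable_comp2:
  "semidecidable (\<lambda>p. P (fst p) (snd p)) \<Longrightarrow> computable f \<Longrightarrow> computable g \<Longrightarrow>
    semidecidable (\<lambda>x. P (f x) (g x))"
  using semidecidable_comp[OF _ semidec_Pair, of "\<lambda>p. P (fst p) (snd p)" f g] by simp

lemma semidecidable_comp3:
  "semidecidable (\<lambda>p. P (fst p) (fst (snd p)) (snd (snd p))) \<Longrightarrow>
    computable f \<Longrightarrow> computable g \<Longrightarrow> computable h \<Longrightarrow> semidecidable (\<lambda>x. P (f x) (g x) (h x))"
  using semidecidable_comp[OF _ semidec_Pair[OF _ semidec_Pair],
    of "\<lambda>p. P (fst p) (fst (snd p)) (snd (snd p))" f g h] by simp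

lemma computable_comp3:
  "computable (\<lambda>p. P (fst p) (fst (snd p)) (snd (snd p))) \<Longrightarrow>
    computable f \<Longrightarrow> computable g \<Longrightarrow> computable h \<Longrightarrow> computable (\<lambda>x. P (f x) (g x) (h x))"
  using computable_comp[OF _ semidec_Pair[OF _ semidec_Pair],
    of "\<lambda>p. P (fst p) (fst (snd p)) (snd (snd p))" f g h] by simp

lemma computable_recursive1:
  assumes "recfun (\<lambda>s. F (s 0))" "\<And>x. enc (f x) = F (enc x)" "computable g"
  shows "computable (\<lambda>x. f (g x))"
proof (rule computable_comp[OF _ assms(3)])
  show "computable f"
  proof (rule computableI)
    show "sigma1 (\<lambda>s. s 1 = F (s 0))" by (intro sigma1_eq recfun_var assms(1))
    show "y = f x \<longleftrightarrow> enc y = F (enc x)" for x y by (simp add: assms(2)[symmetric])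
  qed
qed

lemma computable_recursive2:
  assumes "recfun (\<lambda>s. F (s 0) (s 1))" "\<And>x y. enc (f x y) = F (enc x) (enc y)"
    "computable g" "computable h"
  shows "computable (\<lambda>x. f (g x) (h x))"
proof (rule computable_comp2[OF _ assms(3,4)])
  show "computable (\<lambda>p. f (fst p) (snd p))"
  proof (rule computableI)
    have "recfun (\<lambda>s. F (s 0) (s 1))" by (rule assms(1))
    then have F: "recfun (\<lambda>s. F (f' s) (g' s))" if "recfun f'" "recfun g'" for f' g'
      using recfun_subst[of "\<lambda>s. F (s 0) (s 1)" "\<lambda>i. if i = 0 then f' else g'"] that by simp
    show "sigma1 (\<lambda>s. \<exists>a b. s 0 = prod_encode (a, b) \<and> s 1 = F a b)"
      by (intro sigma1_rules F)
    show "y = f (fst p) (snd p) \<longleftrightarrow> (\<exists>a b. enc p = prod_encode (a, b) \<and> enc y = F a b)" for p y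
      by (auto simp: assms(2)[symmetric] enc_prod_def)
  qed
qed

text \<open>Serves for changes of type that keep the code, such as \<open>enc\<close> itself or the
  passage from a program to its word.\<close>

lemma semidec_enc_preserving: "(\<And>x. enc (f x) = enc x) \<Longrightarrow> computable g \<Longrightarrow> computable (\<lambda>x. f (g x))"
  by (rule computable_recursive1[where F = "\<lambda>n. n"]) (auto intro: recfun_var)

lemma semidec_enc [semidec]: "computable f \<Longrightarrow> computable (\<lambda>x. enc (f x))"
  by (rule semidec_enc_preserving) simp

lemma semidec_Suc [semidec]: "computable f \<Longrightarrow> computable (\<lambda>x. Suc (f x))"
  by (rule computable_recursive1[where F = Suc]) (auto intro: recfun_Suc recfun_var)

lemma semidec_Cons [semidec]:
  assumes "computable f" "computable g" shows "computable (\<lambda>x. f x # g x)"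
  by (rule computable_recursive2[where F = "\<lambda>a b. Suc (prod_encode (a, b))", OF _ _ assms])
    (auto simp: enc_Cons intro!: recfun_prod_encode recfun_Suc recfun_var)

lemma semidec_plus [semidec]:
  assumes "computable f" "computable g" shows "computable (\<lambda>x. f x + g x :: nat)"
  by (rule computable_recursive2[where F = "(+)", OF _ _ assms])
    (auto intro!: recfun_add recfun_var)

lemma semidec_times [semidec]:
  assumes "computable f" "computable g" shows "computable (\<lambda>x. f x * g x :: nat)"
  by (rule computable_recursive2[where F = "(*)", OF _ _ assms])
    (auto intro!: recfun_mult recfun_var)

lemma semidec_prod_encode [semidec]:
  assumes "computable f" "computable g" shows "computable (\<lambda>x. prod_encode (f x, g x))"
  by (rule computable_recursive2[where F = "\<lambda>a b. prod_encode (a, b)", OF _ _ assms])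
    (auto intro!: recfun_prod_encode recfun_var)

lemma semidec_drop [semidec]:
  assumes "computable f" "computable g" shows "computable (\<lambda>x. drop (f x) (g x))"
  by (rule computable_recursive2[where F = "code_drop", OF _ _ assms])
    (auto simp: enc_list_def code_drop drop_map intro!: recfun_code_drop recfun_var)

lemma semidec_bool [semidec]: "semidecidable (\<lambda>x. b)"
proof (cases b)
  case True
  then show ?thesis
    by (intro semidecidableI[where Q = "\<lambda>_. 0 = (0::nat)"])
      (auto intro: sigma1_eq[OF recfun_const recfun_const, of 0 0, simplified])
next
  case False
  then show ?thesis
    by (intro semidecidableI[where Q = "\<lambda>_. False"])
      (auto intro: sigma1_eq[OF recfun_const recfun_const, of 0 1, simplified])
qed

lemma semidec_eq [semidec]:
  fixes f g :: "'a::enc \<Rightarrow> 'b::enc"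
  assumes "computable f" "computable g"
  shows "semidecidable (\<lambda>x. f x = g x)"
proof -
  have "semidecidable (\<lambda>p. fst p = (snd p :: 'b))"
  proof (rule semidecidableI)
    show "sigma1 (\<lambda>s. \<exists>a. s 0 = prod_encode (a, a))" by (intro sigma1_rules)
  qed (auto simp: enc_prod_def)
  then show ?thesis using assms by (rule semidecidable_comp2)
qed

lemma semidec_conj [semidec]:
  assumes "semidecidable P" "semidecidable Q"
  shows "semidecidable (\<lambda>x. P x \<and> Q x)"
proof -
  obtain P' where P': "sigma1 (\<lambda>s. P' (s 0))" "\<And>x. P x \<longleftrightarrow> P' (enc x)"
    using assms(1) unfolding semidecidable_def by blast
  obtain Q' where Q': "sigma1 (\<lambda>s. Q' (s 0))" "\<And>x. Q x \<longleftrightarrow> Q' (enc x)"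
    using assms(2) unfolding semidecidable_def by blast
  show ?thesis
    by (rule semidecidableI[OF sigma1_conj[OF P'(1) Q'(1)]]) (simp add: P'(2) Q'(2))
qed

lemma semidec_disj [semidec]:
  assumes "semidecidable P" "semidecidable Q"
  shows "semidecidable (\<lambda>x. P x \<or> Q x)"
proof -
  obtain P' where P': "sigma1 (\<lambda>s. P' (s 0))" "\<And>x. P x \<longleftrightarrow> P' (enc x)"
    using assms(1) unfolding semidecidable_def by blast
  obtain Q' where Q': "sigma1 (\<lambda>s. Q' (s 0))" "\<And>x. Q x \<longleftrightarrow> Q' (enc x)"
    using assms(2) unfolding semidecidable_def by blast
  show ?thesis
    by (rule semidecidableI[OF sigma1_disj[OF P'(1) Q'(1)]]) (simp add: P'(2) Q'(2))
qed

lemma semidec_ex [semidec]: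
  fixes P :: "'a::enc \<Rightarrow> 'b::enc \<Rightarrow> bool"
  assumes "semidecidable (\<lambda>p. P (fst p) (snd p))"
  shows "semidecidable (\<lambda>x. \<exists>y. P x y)"
proof -
  obtain Q where Q: "sigma1 (\<lambda>s. Q (s 0))" "\<And>p. P (fst p) (snd p) \<longleftrightarrow> Q (enc p)"
    using assms unfolding semidecidable_def by blast
  have P: "P x y \<longleftrightarrow> Q (prod_encode (enc x, enc y))" for x y using Q(2)[of "(x, y)"]
    by (simp add: enc_Pair)
  show ?thesis
  proof (rule semidecidableI)
    show "sigma1 (\<lambda>s. \<exists>n. coded TYPE('b) n \<and> Q (prod_encode (s 0, n)))"
      by (intro sigma1_ex sigma1_conj sigma1_coded sigma1_subst1[OF Q(1)] recfun_prod_encode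
        recfun_var)
  qed (auto simp: coded_def P)
qed

lemma semidec_all_less [semidec]:
  fixes P :: "'a::enc \<Rightarrow> nat \<Rightarrow> bool"
  assumes "semidecidable (\<lambda>p. P (fst p) (snd p))" "computable n"
  shows "semidecidable (\<lambda>x. \<forall>i<n x. P x i)"
proof -
  obtain Q where Q: "sigma1 (\<lambda>s. Q (s 0))" "\<And>p. P (fst p) (snd p) \<longleftrightarrow> Q (enc p)"
    using assms(1) unfolding semidecidable_def by blast
  have P: "P x y \<longleftrightarrow> Q (prod_encode (enc x, y))" for x y using Q(2)[of "(x, y)"]
    by (simp add: enc_Pair)
  obtain G where G: "sigma1 (\<lambda>s. G (s 0) (s 1))" "\<And>x y. y = n x \<longleftrightarrow> G (enc x) (enc y)"
    using assms(2) unfolding computable_def by blast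
  show ?thesis
  proof (rule semidecidableI)
    show "sigma1 (\<lambda>s. \<exists>m. G (s 0) m \<and> (\<forall>i<m. Q (prod_encode (s 0, i))))"
      by (intro sigma1_ex sigma1_conj sigma1_all sigma1_subst2[OF G(1)] sigma1_subst1[OF Q(1)]
        recfun_prod_encode recfun_var)
  qed (auto simp: P G(2)[symmetric, unfolded enc_nat_def])
qed

text \<open>Reduces the computability of a function to a relation, for which inference rules or an
  existential description can be given.\<close>

lemma computable_iff_graph: "computable f \<longleftrightarrow> semidecidable (\<lambda>p. snd p = f (fst p))"
proof
  assume f: "computable f"
  show "semidecidable (\<lambda>p. snd p = f (fst p))"
    by (rule semidec_eq[OF computable_snd computable_comp[OF f computable_fst]])
next
  assume "semidecidable (\<lambda>p. snd p = f (fst p))"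
  then obtain Q where Q: "sigma1 (\<lambda>s. Q (s 0))" "\<And>p. snd p = f (fst p) \<longleftrightarrow> Q (enc p)"
    unfolding semidecidable_def by blast
  show "computable f"
  proof (rule computableI)
    show "sigma1 (\<lambda>s. Q (prod_encode (s 0, s 1)))"
      by (intro sigma1_subst1[OF Q(1)] recfun_prod_encode recfun_var)
    show "y = f x \<longleftrightarrow> Q (prod_encode (enc x, enc y))" for x y
      using Q(2)[of "(x, y)"] by (simp add: enc_Pair)
  qed
qed

lemma semidec_less [semidec]:
  assumes "computable f" "computable g"
  shows "semidecidable (\<lambda>x. f x < (g x :: nat))"
proof -
  have "semidecidable (\<lambda>x. \<exists>k. g x = Suc (f x + k))"
    by (rule semidec_ex)
      (intro semidec semidec_id computable_comp[OF assms(1)] computable_comp[OF assms(2)])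
  then show ?thesis by (simp add: less_iff_Suc_add)
qed

text \<open>Semidecidability is not closed under negation; distinct elements, however, have distinct
  natural numbers as codes, one of which is smaller.\<close>

lemma semidec_neq [semidec]:
  assumes "computable f" "computable g"
  shows "semidecidable (\<lambda>x. f x \<noteq> g x)"
proof -
  have "semidecidable (\<lambda>x. enc (f x) < enc (g x) \<or> enc (g x) < enc (f x))"
    by (intro semidec assms)
  then show ?thesis by (simp add: nat_neq_iff[symmetric])
qed

lemma semidecidable_re_nat:
  assumes "semidecidable (P :: 'a::enc \<Rightarrow> bool)"
  shows "re_nat (enc ` {x. P x})"
proof -
  obtain Q where Q: "sigma1 (\<lambda>s. Q (s 0))" "\<And>x. P x \<longleftrightarrow> Q (enc x)"
    using assms unfolding semidecidable_def by blast
  have "re_nat {n. coded TYPE('a) n \<and> Q n}"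
    by (rule sigma1_re_nat) (intro sigma1_conj sigma1_coded recfun_var Q(1))
  also have "{n. coded TYPE('a) n \<and> Q n} = enc ` {x. P x}" by (auto simp: coded_def Q(2))
  finally show ?thesis .
qed

declare semidec_id [semidec]

section \<open>Derivability from semidecidable rules\<close>

text \<open>An entry is tested against its own tail, which excludes circular justifications in a
  derivation.\<close>

primrec all_suffixes :: "('a \<Rightarrow> 'a list \<Rightarrow> bool) \<Rightarrow> 'a list \<Rightarrow> bool" where
  "all_suffixes P [] \<longleftrightarrow> True"
| "all_suffixes P (x # xs) \<longleftrightarrow> P x xs \<and> all_suffixes P xs"

text \<open>The recursion over the list becomes a bounded quantifier. Its bound is any n that
  exhausts the list, since the computability of \<open>length\<close> is itself derived from this
  result later.\<close>

lemma all_suffixes_drop: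
  "all_suffixes P l \<longleftrightarrow>
    (\<exists>n. drop n l = [] \<and> (\<forall>i<n. drop i l = [] \<or> (\<exists>x xs. drop i l = x # xs \<and> P x xs)))"
proof
  assume "all_suffixes P l"
  then have "drop i l = [] \<or> (\<exists>x xs. drop i l = x # xs \<and> P x xs)" for i
    by (induction l arbitrary: i) (auto simp: drop_Cons split: nat.split)
  then have "\<forall>i<length l. drop i l = [] \<or> (\<exists>x xs. drop i l = x # xs \<and> P x xs)"
    by blast
  then show "\<exists>n. drop n l = [] \<and> (\<forall>i<n. drop i l = [] \<or> (\<exists>x xs. drop i l = x # xs \<and> P x xs))"
    by (intro exI[of _ "length l"] conjI drop_all order.refl)
next
  assume "\<exists>n. drop n l = [] \<and> (\<forall>i<n. drop i l = [] \<or> (\<exists>x xs. drop i l = x # xs \<and> P x xs))"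
  then obtain n where "drop n l = []" "\<forall>i<n. drop i l = [] \<or> (\<exists>x xs. drop i l = x # xs \<and> P x xs)"
    by blast
  then show "all_suffixes P l"
  proof (induction l arbitrary: n)
    case (Cons a l)
    then show ?case by (cases n) (auto simp: All_less_Suc2)
  qed simp
qed

lemma semidec_all_suffixes [semidec]:
  assumes P: "semidecidable (\<lambda>p. P (fst p) (fst (snd p)) (snd (snd p)))" and l: "computable l"
  shows "semidecidable (\<lambda>z. all_suffixes (P z) (l z))"
  unfolding all_suffixes_drop
  by (intro semidec semidecidable_comp3[OF P] computable_comp[OF l])

lemma semidec_Ball [semidec]:
  assumes P: "semidecidable (\<lambda>p. P (fst p) (snd p))" and l: "computable l"
  shows "semidecidable (\<lambda>z. \<forall>x\<in>set (l z). P z x)"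
proof -
  have "semidecidable (\<lambda>z. all_suffixes (\<lambda>x xs. P z x) (l z))"
    by (intro semidec semidecidable_comp2[OF P] l)
  moreover have "all_suffixes (\<lambda>x xs. R x) ys \<longleftrightarrow> (\<forall>x\<in>set ys. R x)" for R :: "'b \<Rightarrow> bool" and ys
    by (induction ys) auto
  ultimately show ?thesis by simp
qed

lemma semidec_member [semidec]:
  assumes f: "computable f" and l: "computable l"
  shows "semidecidable (\<lambda>z. f z \<in> set (l z))"
proof -
  have "semidecidable (\<lambda>z. \<exists>i xs. drop i (l z) = f z # xs)"
    by (intro semidec computable_comp[OF l] computable_comp[OF f])
  moreover have "(\<exists>i xs. drop i ys = x # xs) \<longleftrightarrow> x \<in> set ys" for x :: 'b and ys
    by (metis Cons_nth_drop_Suc in_set_conv_nth in_set_dropD list.set_intros(1))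
  ultimately show ?thesis by simp
qed

inductive derivable :: "('a \<Rightarrow> 'a list \<Rightarrow> bool) \<Rightarrow> 'a \<Rightarrow> bool" for R where
  derivableI: "R x L \<Longrightarrow> \<forall>y\<in>set L. derivable R y \<Longrightarrow> derivable R x"

abbreviation derivation :: "('a \<Rightarrow> 'a list \<Rightarrow> bool) \<Rightarrow> 'a list \<Rightarrow> bool" where
  "derivation R \<equiv> all_suffixes (\<lambda>x xs. \<exists>L. R x L \<and> (\<forall>y\<in>set L. y \<in> set xs))"

lemma derivation_append: "derivation R D \<Longrightarrow> derivation R E \<Longrightarrow> derivation R (D @ E)"
  by (induction D) auto

lemma derivable_iff_derivation: "derivable R x \<longleftrightarrow> (\<exists>D. derivation R D \<and> x \<in> set D)"
proof
  assume "derivable R x"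
  then show "\<exists>D. derivation R D \<and> x \<in> set D"
  proof (induction rule: derivable.induct)
    case (derivableI x L)
    have "\<exists>D. derivation R D \<and> set M \<subseteq> set D" if "set M \<subseteq> set L" for M
      using that
    proof (induction M)
      case (Cons y M)
      then obtain D E where "derivation R D" "y \<in> set D" "derivation R E" "set M \<subseteq> set E"
        using derivableI.IH by auto
      then show ?case by (intro exI[of _ "D @ E"]) (auto intro: derivation_append)
    qed (auto intro: exI[of _ "[]"])
    then obtain D where "derivation R D" "set L \<subseteq> set D" by blast
    then show ?case using derivableI.hyps by (intro exI[of _ "x # D"]) auto
  qed
next
  have "derivation R D \<Longrightarrow> x \<in> set D \<Longrightarrow> derivable R x" for D
  proof (induction D arbitrary: x)
    case (Cons y D)
    have "derivable R y"
      using Cons.prems(1) Cons.IH by (auto intro: derivableI)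
    then show ?case using Cons by auto
  qed simp
  then show "\<exists>D. derivation R D \<and> x \<in> set D \<Longrightarrow> derivable R x" by blast
qed

lemma semidecidable_derivable:
  assumes "semidecidable (\<lambda>p. R (fst p) (snd p))"
  shows "semidecidable (derivable R)"
proof -
  have "semidecidable (\<lambda>x. \<exists>D. derivation R D \<and> x \<in> set D)"
    by (intro semidec semidecidable_comp2[OF assms])
  then show ?thesis unfolding derivable_iff_derivation[symmetric] .
qed

text \<open>Soundness is asked for a single rule application only, while completeness is left to
  whatever induction suits \<open>P\<close>. As \<open>R\<close> is merely semidecidable, a rule may
  contain unbounded searches of its own.\<close>

lemma semidecidable_by_rules:
  assumes R: "semidecidable (\<lambda>p. R (fst p) (snd p))"
    and sound: "\<And>x L. R x L \<Longrightarrow> \<forall>y\<in>set L. P y \<Longrightarrow> P x"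
    and complete: "\<And>x. P x \<Longrightarrow> derivable R x"
  shows "semidecidable P"
proof -
  have "derivable R x \<Longrightarrow> P x" for x
    by (induction rule: derivable.induct) (auto intro: sound)
  then have "P = derivable R" using complete by blast
  then show ?thesis using semidecidable_derivable[OF R] by simp
qed

text \<open>The graph is generated by two rules, one for each list constructor. The context z is
  part of every judgement because \<open>f\<close> and \<open>b\<close> depend on it.\<close>

lemma semidec_foldr [semidec]:
  fixes f :: "'x::enc \<Rightarrow> 'a::enc \<Rightarrow> 'b::enc \<Rightarrow> 'b"
  assumes f: "computable (\<lambda>p. f (fst p) (fst (snd p)) (snd (snd p)))"
    and l: "computable l" and b: "computable b"
  shows "computable (\<lambda>z. foldr (f z) (l z) (b z))"
proof -
  let ?R = "\<lambda>(p :: 'x \<times> 'a list \<times> 'b) L.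
    fst (snd p) = [] \<and> snd (snd p) = b (fst p) \<or>
    (\<exists>h t r. fst (snd p) = h # t \<and> snd (snd p) = f (fst p) h r \<and> L = [(fst p, t, r)])"
  let ?P = "\<lambda>p :: 'x \<times> 'a list \<times> 'b. snd (snd p) = foldr (f (fst p)) (fst (snd p)) (b (fst p))"
  have "semidecidable ?P"
  proof (rule semidecidable_by_rules[where R = ?R])
    show "semidecidable (\<lambda>p. ?R (fst p) (snd p))"
      by (intro semidec computable_comp3[OF f] computable_comp[OF b])
  next
    fix p assume "snd (snd p) = foldr (f (fst p)) (fst (snd p)) (b (fst p))"
    moreover have "derivable ?R (z, xs, foldr (f z) xs (b z))" for z xs
    proof (induction xs)
      case Nil
      show ?case by (rule derivableI[where L = "[]"]) auto
    next
      case (Cons x xs)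
      show ?case
        by (rule derivableI[where L = "[(z, xs, foldr (f z) xs (b z))]"]) (use Cons in simp_all)
    qed
    ultimately show "derivable ?R p" by (cases p) simp
  qed auto
  moreover have "computable (\<lambda>q. (fst q, l (fst q), snd q))"
    by (intro semidec computable_comp[OF l])
  ultimately have "semidecidable (\<lambda>q. ?P (fst q, l (fst q), snd q))"
    by (rule semidecidable_comp)
  then have "semidecidable (\<lambda>q. snd q = foldr (f (fst q)) (l (fst q)) (b (fst q)))"
    by simp
  then show ?thesis unfolding computable_iff_graph .
qed

lemma semidec_append [semidec]:
  assumes "computable f" "computable g" shows "computable (\<lambda>z. f z @ g z)"
proof -
  have "computable (\<lambda>z. foldr (#) (f z) (g z))" by (intro semidec assms)
  moreover have "foldr (#) xs ys = xs @ ys" for xs ys :: "'b list" by (induction xs) auto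
  ultimately show ?thesis by simp
qed

lemma semidec_concat [semidec]:
  assumes "computable f" shows "computable (\<lambda>z. concat (f z))"
  unfolding concat_conv_foldr by (intro semidec assms)

lemma semidec_map [semidec]:
  assumes f: "computable (\<lambda>p. f (fst p) (snd p))" and l: "computable l"
  shows "computable (\<lambda>z. map (f z) (l z))"
proof -
  have "computable (\<lambda>z. foldr (\<lambda>x ys. f z x # ys) (l z) [])"
    by (intro semidec l computable_comp2[OF f])
  moreover have "foldr (\<lambda>x ys. h x # ys) xs [] = map h xs" for h :: "'b \<Rightarrow> 'c" and xs
    by (induction xs) auto
  ultimately show ?thesis by simp
qed

lemma semidec_length [semidec]:
  assumes "computable f" shows "computable (\<lambda>z. length (f z))"
proof -
  have "computable (\<lambda>z. foldr (\<lambda>x. Suc) (f z) 0)"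
    by (intro semidec assms)
  moreover have "foldr (\<lambda>x. Suc) xs 0 = length xs" for xs :: "'b list"
    by (induction xs) auto
  ultimately show ?thesis by simp
qed

section \<open>Truth values, finite sets and codes of rationals\<close>

instantiation bool :: enc
begin
definition enc_bool :: "bool \<Rightarrow> nat" where "enc_bool b = of_bool b"
instance
proof
  show "sigma1 (\<lambda>s. \<exists>x::bool. s 0 = enc x)"
    unfolding enc_bool_def ex_bool_eq by (intro sigma1_rules)
qed (auto simp: enc_bool_def of_bool_def split: if_splits)
end

lemma semidec_If [semidec]:
  assumes b: "computable b" and f: "computable f" and g: "computable g"
  shows "computable (\<lambda>z. if b z then f z else g z)"
  unfolding computable_iff_graph
proof -
  have "semidecidable (\<lambda>p. b (fst p) = True \<and> snd p = f (fst p) \<or> b (fst p) = False \<and> snd p = g (fst p))"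
    by (intro semidec computable_comp[OF b] computable_comp[OF f] computable_comp[OF g])
  then show "semidecidable (\<lambda>p. snd p = (if b (fst p) then f (fst p) else g (fst p)))"
    by (rule back_subst[of semidecidable]) auto
qed

text \<open>A finite set can be written into the search procedure; this will admit the transition
  table of a Turing machine.\<close>

lemma semidec_finite [semidec]:
  assumes A: "finite A" and f: "computable f"
  shows "semidecidable (\<lambda>z. f z \<in> A)"
  using A
proof (induction A)
  case empty
  show ?case by (simp add: semidec_bool)
next
  case (insert a A)
  have "semidecidable (\<lambda>z. f z = a \<or> f z \<in> A)" by (intro semidec f insert.IH)
  then show ?case by simp
qed

lemma semidec_cofinite [semidec]:
  assumes A: "finite A" and f: "computable f"
  shows "semidecidable (\<lambda>z. f z \<notin> A)"
  using A
proof (induction A)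
  case empty
  show ?case by (simp add: semidec_bool)
next
  case (insert a A)
  have "semidecidable (\<lambda>z. f z \<noteq> a \<and> f z \<notin> A)" by (intro semidec f insert.IH)
  then show ?case by simp
qed

text \<open>\<open>int_encode\<close> sends i \<ge> 0 to 2 * i and i < 0 to 2 * |i| - 1; parity
  decides which alternative applies.\<close>

lemma abs_int_decode: "a = 2 * k \<or> Suc a = 2 * k \<longleftrightarrow> k = nat \<bar>int_decode a\<bar>"
proof -
  obtain i where a: "a = int_encode i" by (metis int_decode_inverse)
  show ?thesis unfolding a int_encode_inverse by (auto simp: int_encode_def sum_encode_def)
qed

text \<open>Only reduced fractions are codes. Coprimality of b and k is stated as a Bezout identity
  over the naturals, which is purely existential and also excludes b = 0.\<close>

lemma range_rat_code:
  "(\<exists>q. n = rat_code q) \<longleftrightarrow> (\<exists>a b k x y. n = prod_encode (a, b) \<and>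
    (a = 2 * k \<or> Suc a = 2 * k) \<and> b * x = Suc (k * y))"
proof
  assume "\<exists>q. n = rat_code q"
  then obtain q where n: "n = rat_code q" ..
  obtain i d where q: "quotient_of q = (i, d)" by (metis surj_pair)
  have "d > 0" "coprime i d" using q by (auto intro: quotient_of_denom_pos quotient_of_coprime)
  then have "gcd d i = 1" by (metis coprime_commute coprime_iff_gcd_eq_1)
  then have "gcd (nat d) (nat \<bar>i\<bar>) = 1"
    using \<open>d > 0\<close> unfolding gcd_int_def by (simp only: abs_of_pos of_nat_eq_1_iff)
  then obtain x y where "nat d * x = Suc (nat \<bar>i\<bar> * y)"
    using bezout_nat[of "nat d" "nat \<bar>i\<bar>"] \<open>d > 0\<close> by (metis Suc_eq_plus1 nat_0_iff not_le)
  moreover have "n = prod_encode (int_encode i, nat d)" using n q by (simp add: rat_code_def)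
  moreover have "nat \<bar>i\<bar> = nat \<bar>int_decode (int_encode i)\<bar>" by simp
  ultimately show "\<exists>a b k x y. n = prod_encode (a, b) \<and> (a = 2 * k \<or> Suc a = 2 * k) \<and> b * x = Suc (k * y)"
    unfolding abs_int_decode by blast
next
  assume "\<exists>a b k x y. n = prod_encode (a, b) \<and> (a = 2 * k \<or> Suc a = 2 * k) \<and> b * x = Suc (k * y)"
  then obtain a b x y where n: "n = prod_encode (a, b)"
    and *: "b * x = Suc (nat \<bar>int_decode a\<bar> * y)"
    unfolding abs_int_decode by blast
  have "b > 0" by (rule ccontr) (use * in simp)
  define k where "k = nat \<bar>int_decode a\<bar>"
  have "gcd k b dvd Suc (k * y)" by (simp flip: *[folded k_def])
  then have "gcd k b dvd 1" using dvd_add_right_iff[of "gcd k b" "k * y" 1] by simp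
  then have "gcd (int_decode a) (int b) = 1" unfolding gcd_int_def k_def
    by (simp only: abs_of_nat nat_int nat_dvd_1_iff_1 of_nat_1)
  then have "coprime (int_decode a) (int b)" by (rule gcd_eq_1_imp_coprime)
  then have "rat_code (Fract (int_decode a) (int b)) = n"
    using \<open>b > 0\<close> n by (simp add: rat_code_def quotient_of_Fract normalize_stable)
  then show "\<exists>q. n = rat_code q" by metis
qed

instantiation rat :: enc
begin
definition enc_rat :: "rat \<Rightarrow> nat" where "enc_rat = rat_code"
instance
proof
  show "sigma1 (\<lambda>s. \<exists>x::rat. s 0 = enc x)"
    unfolding enc_rat_def range_rat_code
    by (intro sigma1_rules)
qed (auto simp: enc_rat_def dest: injD[OF inj_rat_code])
end

section \<open>Codes for programs, terms and formulae\<close>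

text \<open>The halving is read backwards: the quotient m and the digit b are guessed, and checking
  them takes only doubling.\<close>

lemma semidec_nat_word [semidec]:
  assumes "computable f" shows "computable (\<lambda>z. nat_word (f z))"
proof -
  let ?R = "\<lambda>(p :: nat \<times> bool list) L. p = (0, [False]) \<or>
    (\<exists>m b w. (fst p = 2 * m \<and> b = False \<or> fst p = Suc (2 * m) \<and> b = True) \<and> fst p \<noteq> 0 \<and>
      snd p = True # b # w \<and> L = [(m, w)])"
  have "semidecidable (\<lambda>p. snd p = nat_word (fst p))"
  proof (rule semidecidable_by_rules[where R = ?R])
    show "semidecidable (\<lambda>p. ?R (fst p) (snd p))" by (intro semidec)
  next
    fix p :: "nat \<times> bool list" and L
    assume "?R p L" "\<forall>q\<in>set L. snd q = nat_word (fst q)"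
    then show "snd p = nat_word (fst p)"
      by (auto simp: nat_word.simps[of 0] nat_word.simps[of "fst p"])
  next
    fix p :: "nat \<times> bool list" assume p: "snd p = nat_word (fst p)"
    have "derivable ?R (n, nat_word n)" for n
    proof (induction n rule: less_induct)
      case (less n)
      show ?case
      proof (cases "n = 0")
        case True
        show ?thesis by (rule derivableI[where L = "[]"]) (simp_all add: True nat_word.simps[of 0])
      next
        case False
        then have IH: "derivable ?R (n div 2, nat_word (n div 2))" by (intro less) simp
        have "n = 2 * (n div 2) \<and> odd n = False \<or> n = Suc (2 * (n div 2)) \<and> odd n = True" by presburger
        then have "?R (n, nat_word n) [(n div 2, nat_word (n div 2))]"
          unfolding fst_conv snd_conv
          by (intro disjI2 exI[of _ "n div 2"] exI[of _ "odd n"] exI[of _ "nat_word (n div 2)"])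
            (simp_all add: False nat_word.simps[of n])
        then show ?thesis by (rule derivableI) (use IH in auto)
      qed
    qed
    then show "derivable ?R p" using p by (cases p) simp
  qed
  then have "computable nat_word" unfolding computable_iff_graph .
  then show ?thesis using assms by (rule computable_comp)
qed

text \<open>Provides the range condition of \<open>enc\<close> for a type that is coded through
  words.\<close>

lemma sigma1_range_semidecidable:
  assumes "semidecidable (P :: 'a::enc \<Rightarrow> bool)"
  shows "sigma1 (\<lambda>s. \<exists>x. P x \<and> s 0 = enc x)"
proof -
  obtain Q where Q: "sigma1 (\<lambda>s. Q (s 0))" "\<And>x. P x \<longleftrightarrow> Q (enc x)"
    using assms unfolding semidecidable_def by blast
  have "sigma1 (\<lambda>s. coded TYPE('a) (s 0) \<and> Q (s 0))"
    by (intro sigma1_conj sigma1_coded recfun_var Q(1))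
  then show ?thesis by (rule back_subst[of sigma1]) (auto simp: coded_def Q(2) fun_eq_iff)
qed

text \<open>Parsing by rules: the cuts between the parts are guessed, and the premises demand that
  the parts are programs. The rules speak of words because \<open>rec_code\<close> becomes a coded
  type only through this lemma.\<close>

lemma semidecidable_rec_code_words: "semidecidable (\<lambda>w. \<exists>e. w = rec_code_word e)"
proof -
  let ?R = "\<lambda>w L. w = nat_word 0 \<or> w = nat_word 1 \<or> (\<exists>i. w = nat_word 2 @ nat_word i) \<or>
    (\<exists>f gs. w = nat_word 3 @ f @ nat_word (length gs) @ concat gs \<and> L = f # gs) \<or>
    (\<exists>f g. w = nat_word 4 @ f @ g \<and> L = [f, g]) \<or> (\<exists>f. w = nat_word 5 @ f \<and> L = [f])"
  show ?thesis
  proof (rule semidecidable_by_rules[where R = ?R])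
    show "semidecidable (\<lambda>p. ?R (fst p) (snd p))" by (intro semidec)
  next
    fix w L assume R: "?R w L" and L: "\<forall>v\<in>set L. \<exists>e. v = rec_code_word e"
    obtain es where es: "L = map rec_code_word es" using L ex_map_conv[of L rec_code_word] by blast
    from R consider "w = rec_code_word Zero" | "w = rec_code_word Succ" | i where "w = rec_code_word (Proj i)"
      | f gs where "w = nat_word 3 @ f @ nat_word (length gs) @ concat gs" "L = f # gs"
      | f g where "w = nat_word 4 @ f @ g" "L = [f, g]" | f where "w = nat_word 5 @ f" "L = [f]"
      by auto
    then show "\<exists>e. w = rec_code_word e"
    proof cases
      case 4
      then obtain e es' where "f = rec_code_word e" "gs = map rec_code_word es'" using es
        by (cases es) auto
      then show ?thesis using 4 by (intro exI[of _ "Comp e es'"]) simp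
    next
      case 5
      then obtain e e' where "f = rec_code_word e" "g = rec_code_word e'" using es
        by (auto simp: Cons_eq_map_conv)
      then show ?thesis using 5 by (intro exI[of _ "PrimRec e e'"]) simp
    next
      case 6
      then obtain e where "f = rec_code_word e" using es by (auto simp: Cons_eq_map_conv)
      then show ?thesis using 6 by (intro exI[of _ "Minim e"]) simp
    qed blast+
  next
    define R where "R = ?R"
    have "derivable R (rec_code_word e)" for e
    proof (induction e)
      case Zero
      show ?case by (rule derivableI[of R _ "[]"]) (auto simp: R_def)
    next
      case Succ
      show ?case by (rule derivableI[of R _ "[]"]) (auto simp: R_def)
    next
      case (Proj i)
      show ?case by (rule derivableI[of R _ "[]"]) (auto simp: R_def)
    next
      case (Comp f gs)
      have "R (rec_code_word (Comp f gs)) (rec_code_word f # map rec_code_word gs)"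
        by (auto simp: R_def)
      then show ?case by (rule derivableI[of R]) (use Comp in auto)
    next
      case (PrimRec f g)
      have "R (rec_code_word (PrimRec f g)) [rec_code_word f, rec_code_word g]"
        by (auto simp: R_def)
      then show ?case by (rule derivableI[of R]) (use PrimRec in auto)
    next
      case (Minim f)
      have "R (rec_code_word (Minim f)) [rec_code_word f]" by (auto simp: R_def)
      then show ?case by (rule derivableI[of R]) (use Minim in auto)
    qed
    then show "\<exists>e. w = rec_code_word e \<Longrightarrow> derivable ?R w" for w unfolding R_def by blast
  qed
qed

instantiation rec_code :: enc
begin
definition enc_rec_code :: "rec_code \<Rightarrow> nat" where "enc_rec_code e = enc (rec_code_word e)"
instance
proof
  show "enc e = enc e' \<Longrightarrow> e = e'" for e e' :: rec_code
    using rec_code_word_cancel[of e "[]" e' "[]"] by (simp add: enc_rec_code_def)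
  show "sigma1 (\<lambda>s. \<exists>e::rec_code. s 0 = enc e)"
    using sigma1_range_semidecidable[OF semidecidable_rec_code_words]
    by (rule back_subst[of sigma1]) (auto simp: enc_rec_code_def fun_eq_iff)
qed
end

text \<open>Programs are a coded type by now, so the function symbol of an application is quantified
  directly instead of being parsed by premises.\<close>

lemma semidecidable_term_words: "semidecidable (\<lambda>w. \<exists>t. w = term_word t)"
proof -
  let ?R = "\<lambda>w L. (\<exists>v. w = nat_word 0 @ nat_word v) \<or> w = nat_word 1 \<or> w = nat_word 2 \<or>
    (\<exists>t u. w = nat_word 3 @ t @ u \<and> L = [t, u]) \<or> (\<exists>t u. w = nat_word 4 @ t @ u \<and> L = [t, u]) \<or>
    (\<exists>e. w = nat_word 5 @ rec_code_word e @ nat_word (length L) @ concat L)"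
  have [semidec]: "computable f \<Longrightarrow> computable (\<lambda>z. rec_code_word (f z))" for f :: "'a::enc \<Rightarrow> _"
    by (rule semidec_enc_preserving) (simp add: enc_rec_code_def)
  show ?thesis
  proof (rule semidecidable_by_rules[where R = ?R])
    show "semidecidable (\<lambda>p. ?R (fst p) (snd p))" by (intro semidec)
  next
    fix w L assume R: "?R w L" and L: "\<forall>v\<in>set L. \<exists>t. v = term_word t"
    obtain ts where ts: "L = map term_word ts" using L ex_map_conv[of L term_word] by blast
    from R consider v where "w = term_word (Var v)" | "w = term_word Const0" | "w = term_word Const1"
      | t u where "w = nat_word 3 @ t @ u" "L = [t, u]" | t u where "w = nat_word 4 @ t @ u" "L = [t, u]"
      | e where "w = term_word (App e ts)"
      by (auto simp: ts)
    then show "\<exists>t. w = term_word t"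
    proof cases
      case 4
      then obtain x y where "t = term_word x" "u = term_word y" using ts
        by (auto simp: Cons_eq_map_conv)
      then show ?thesis using 4 by (intro exI[of _ "Plus x y"]) simp
    next
      case 5
      then obtain x y where "t = term_word x" "u = term_word y" using ts
        by (auto simp: Cons_eq_map_conv)
      then show ?thesis using 5 by (intro exI[of _ "Times x y"]) simp
    qed blast+
  next
    define R where "R = ?R"
    have "derivable R (term_word t)" for t
    proof (induction t)
      case (Var v)
      show ?case by (rule derivableI[of R _ "[]"]) (auto simp: R_def)
    next
      case Const0
      show ?case by (rule derivableI[of R _ "[]"]) (auto simp: R_def)
    next
      case Const1
      show ?case by (rule derivableI[of R _ "[]"]) (auto simp: R_def)
    next
      case (Plus t u)
      have "R (term_word (Plus t u)) [term_word t, term_word u]" by (auto simp: R_def)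
      then show ?case by (rule derivableI[of R]) (use Plus in auto)
    next
      case (Times t u)
      have "R (term_word (Times t u)) [term_word t, term_word u]" by (auto simp: R_def)
      then show ?case by (rule derivableI[of R]) (use Times in auto)
    next
      case (App e ts)
      have "R (term_word (App e ts)) (map term_word ts)" by (auto simp: R_def)
      then show ?case by (rule derivableI[of R]) (use App in auto)
    qed
    then show "\<exists>t. w = term_word t \<Longrightarrow> derivable ?R w" for w unfolding R_def by blast
  qed
qed

instantiation ecf_term :: enc
begin
definition enc_ecf_term :: "ecf_term \<Rightarrow> nat" where "enc_ecf_term t = enc (term_word t)"
instance
proof
  show "enc t = enc u \<Longrightarrow> t = u" for t u :: ecf_term
    using term_word_cancel[of t "[]" u "[]"] by (simp add: enc_ecf_term_def)
  show "sigma1 (\<lambda>s. \<exists>t::ecf_term. s 0 = enc t)"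
    using sigma1_range_semidecidable[OF semidecidable_term_words]
    by (rule back_subst[of sigma1]) (auto simp: enc_ecf_term_def fun_eq_iff)
qed
end

lemma semidecidable_formula_words: "semidecidable (\<lambda>w. \<exists>\<phi>. w = formula_word \<phi>)"
proof -
  let ?R = "\<lambda>w L. (\<exists>t u. w = nat_word 0 @ term_word t @ term_word u) \<or>
    (\<exists>t u. w = nat_word 1 @ term_word t @ term_word u) \<or>
    (\<exists>\<phi> \<psi>. w = nat_word 2 @ \<phi> @ \<psi> \<and> L = [\<phi>, \<psi>]) \<or> (\<exists>\<phi> \<psi>. w = nat_word 3 @ \<phi> @ \<psi> \<and> L = [\<phi>, \<psi>]) \<or>
    (\<exists>v \<phi>. w = nat_word 4 @ nat_word v @ \<phi> \<and> L = [\<phi>])"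
  have [semidec]: "computable f \<Longrightarrow> computable (\<lambda>z. term_word (f z))" for f :: "'a::enc \<Rightarrow> _"
    by (rule semidec_enc_preserving) (simp add: enc_ecf_term_def)
  show ?thesis
  proof (rule semidecidable_by_rules[where R = ?R])
    show "semidecidable (\<lambda>p. ?R (fst p) (snd p))" by (intro semidec)
  next
    fix w L assume R: "?R w L" and L: "\<forall>v\<in>set L. \<exists>\<phi>. v = formula_word \<phi>"
    from R consider t u where "w = formula_word (Less t u)" | t u where "w = formula_word (Equal t u)"
      | x y where "w = nat_word 2 @ x @ y" "L = [x, y]" | x y where "w = nat_word 3 @ x @ y" "L = [x, y]"
      | v x where "w = nat_word 4 @ nat_word v @ x" "L = [x]"
      by auto
    then show "\<exists>\<phi>. w = formula_word \<phi>"
    proof cases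
      case 3
      then obtain \<phi> \<psi> where "x = formula_word \<phi>" "y = formula_word \<psi>" using L by auto
      then show ?thesis using 3 by (intro exI[of _ "Conj \<phi> \<psi>"]) simp
    next
      case 4
      then obtain \<phi> \<psi> where "x = formula_word \<phi>" "y = formula_word \<psi>" using L by auto
      then show ?thesis using 4 by (intro exI[of _ "Disj \<phi> \<psi>"]) simp
    next
      case 5
      then obtain \<phi> where "x = formula_word \<phi>" using L by auto
      then show ?thesis using 5 by (intro exI[of _ "Exists v \<phi>"]) simp
    qed blast+
  next
    define R where "R = ?R"
    have "derivable R (formula_word \<phi>)" for \<phi>
    proof (induction \<phi>)
      case (Less t u)
      have "R (formula_word (Less t u)) []" by (auto simp: R_def)
      then show ?case by (rule derivableI[of R]) simp
    next
      case (Equal t u)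
      have "R (formula_word (Equal t u)) []" by (auto simp: R_def)
      then show ?case by (rule derivableI[of R]) simp
    next
      case (Conj \<phi> \<psi>)
      have "R (formula_word (Conj \<phi> \<psi>)) [formula_word \<phi>, formula_word \<psi>]" by (auto simp: R_def)
      then show ?case by (rule derivableI[of R]) (use Conj in auto)
    next
      case (Disj \<phi> \<psi>)
      have "R (formula_word (Disj \<phi> \<psi>)) [formula_word \<phi>, formula_word \<psi>]" by (auto simp: R_def)
      then show ?case by (rule derivableI[of R]) (use Disj in auto)
    next
      case (Exists v \<phi>)
      have "R (formula_word (Exists v \<phi>)) [formula_word \<phi>]" by (auto simp: R_def)
      then show ?case by (rule derivableI[of R]) (use Exists in auto)
    qed
    then show "\<exists>\<phi>. w = formula_word \<phi> \<Longrightarrow> derivable ?R w" for w unfolding R_def by blast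
  qed
qed

instantiation ex_formula :: enc
begin
definition enc_ex_formula :: "ex_formula \<Rightarrow> nat" where "enc_ex_formula \<phi> = enc (formula_word \<phi>)"
instance
proof
  show "enc \<phi> = enc \<psi> \<Longrightarrow> \<phi> = \<psi>" for \<phi> \<psi> :: ex_formula
    using inj_formula_word by (simp add: enc_ex_formula_def inj_eq)
  show "sigma1 (\<lambda>s. \<exists>\<phi>::ex_formula. s 0 = enc \<phi>)"
    using sigma1_range_semidecidable[OF semidecidable_formula_words]
    by (rule back_subst[of sigma1]) (auto simp: enc_ex_formula_def fun_eq_iff)
qed
end

text \<open>Meant for constructors: the word of a compound expression is a computable concatenation
  of the words of its parts, and passing between expression and word keeps the code.\<close>

lemma computable_up_to_coding:
  fixes f :: "'a::enc \<Rightarrow> 'b::enc" and g :: "'b \<Rightarrow> 'c::enc"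
  assumes "\<And>x. enc (g x) = enc x" and g: "computable (\<lambda>z. g (f z))"
  shows "computable f"
proof -
  have "computable g" using semidec_enc_preserving[of g "\<lambda>x. x"] assms(1) semidec_id by blast
  then have "semidecidable (\<lambda>p. g (snd p) = g (f (fst p)))"
    by (intro semidec_eq computable_comp[OF assms(2)] computable_comp[OF \<open>computable g\<close>]
      computable_fst computable_snd)
  moreover have "g x = g y \<longleftrightarrow> x = y" for x y by (metis assms(1) enc_inject)
  ultimately show ?thesis unfolding computable_iff_graph by simp
qed

lemma enc_words:
  "enc (rec_code_word e) = enc e" "enc (term_word t) = enc t" "enc (formula_word \<phi>) = enc \<phi>"
  by (simp_all add: enc_rec_code_def enc_ecf_term_def enc_ex_formula_def)

lemmas semidec_words [semidec] =
  semidec_enc_preserving[of rec_code_word, OF enc_words(1)]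
  semidec_enc_preserving[of term_word, OF enc_words(2)]
  semidec_enc_preserving[of formula_word, OF enc_words(3)]

lemma semidec_constructors [semidec]:
  fixes n :: "'a::enc \<Rightarrow> nat"
  shows "computable n \<Longrightarrow> computable (\<lambda>z. Proj (n z))"
    and "computable e \<Longrightarrow> computable es \<Longrightarrow> computable (\<lambda>z::'a. Comp (e z) (es z))"
    and "computable e \<Longrightarrow> computable e' \<Longrightarrow> computable (\<lambda>z::'a. PrimRec (e z) (e' z))"
    and "computable e \<Longrightarrow> computable (\<lambda>z::'a. Minim (e z))"
    and "computable n \<Longrightarrow> computable (\<lambda>z. Var (n z))"
    and "computable t \<Longrightarrow> computable u \<Longrightarrow> computable (\<lambda>z::'a. Plus (t z) (u z))"
    and "computable t \<Longrightarrow> computable u \<Longrightarrow> computable (\<lambda>z::'a. Times (t z) (u z))"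
    and "computable e \<Longrightarrow> computable ts \<Longrightarrow> computable (\<lambda>z::'a. App (e z) (ts z))"
    and "computable t \<Longrightarrow> computable u \<Longrightarrow> computable (\<lambda>z::'a. Less (t z) (u z))"
    and "computable \<phi> \<Longrightarrow> computable \<psi> \<Longrightarrow> computable (\<lambda>z::'a. Conj (\<phi> z) (\<psi> z))"
    and "computable \<phi> \<Longrightarrow> computable \<psi> \<Longrightarrow> computable (\<lambda>z::'a. Disj (\<phi> z) (\<psi> z))"
    and "computable n \<Longrightarrow> computable \<phi> \<Longrightarrow> computable (\<lambda>z. Exists (n z) (\<phi> z))"
  by (rule computable_up_to_coding[OF enc_words(1)] computable_up_to_coding[OF enc_words(2)]
      computable_up_to_coding[OF enc_words(3)],
      (simp only: rec_code_word.simps term_word.simps formula_word.simps; intro semidec; assumption))+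

section \<open>Universality, rational arithmetic and Turing machines\<close>

text \<open>For \<open>Comp\<close>, the list \<open>M\<close> pairs each inner program with its
  value, so that the pointwise condition turns into a list of premises. For \<open>Minim\<close>, it
  has to contain a positive value for each smaller argument. \<open>Proj\<close> uses
  \<open>drop\<close>, which is already available as a computable operation.\<close>

inductive rec_rule :: "rec_code \<times> nat list \<times> nat \<Rightarrow> (rec_code \<times> nat list \<times> nat) list \<Rightarrow> bool" where
  "rec_rule (Zero, xs, 0) []"
| "rec_rule (Succ, [x], Suc x) []"
| "drop i xs = y # us \<Longrightarrow> rec_rule (Proj i, xs, y) []"
| "rec_rule (Comp f (map fst M), xs, y) ((f, map snd M, y) # map (\<lambda>q. (fst q, xs, snd q)) M)"
| "rec_rule (PrimRec f g, 0 # xs, y) [(f, xs, y)]"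
| "rec_rule (PrimRec f g, Suc n # xs, y) [(PrimRec f g, n # xs, r), (g, n # r # xs, y)]"
| "\<forall>i<y. \<exists>m. (f, i # xs, Suc m) \<in> set M \<Longrightarrow> rec_rule (Minim f, xs, y) ((f, y # xs, 0) # M)"

lemma rec_rule_sound:
  "rec_rule p L \<Longrightarrow> \<forall>(e, xs, y)\<in>set L. rec_computes e xs y \<Longrightarrow>
    case p of (e, xs, y) \<Rightarrow> rec_computes e xs y"
proof (induction rule: rec_rule.induct)
  case (3 i xs y us)
  then have "i < length xs" by (metis drop_all list.distinct(1) not_le)
  moreover from this 3 have "xs ! i = y" by (metis hd_drop_conv_nth list.sel(1))
  ultimately show ?case using rc_Proj[of i xs] by simp
next
  case (4 f M xs y)
  then show ?case by (auto intro!: rc_Comp[where ys = "map snd M"] simp: list_all2_conv_all_nth)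
next
  case (7 y f xs M)
  then show ?case by (fastforce intro!: rc_Minim)
qed (auto intro: rc_Zero rc_Succ rc_PrimRec_0 rc_PrimRec_Suc)

lemma rec_rule_complete: "rec_computes e xs y \<Longrightarrow> derivable rec_rule (e, xs, y)"
proof (induction rule: rec_computes.induct)
  case (rc_Zero xs)
  show ?case by (rule derivableI[of rec_rule, OF rec_rule.intros(1)]) simp
next
  case (rc_Succ x)
  show ?case by (rule derivableI[of rec_rule, OF rec_rule.intros(2)]) simp
next
  case (rc_Proj i xs)
  show ?case
    by (rule derivableI[of rec_rule, OF rec_rule.intros(3)[OF Cons_nth_drop_Suc[OF rc_Proj, symmetric]]]) simp
next
  case (rc_Comp xs gs ys f z)
  define M where "M = zip gs ys"
  have "length gs = length ys" using rc_Comp.IH(1) by (rule list_all2_lengthD)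
  then have M: "gs = map fst M" "ys = map snd M" by (simp_all add: M_def)
  have "derivable rec_rule (fst q, xs, snd q)" if "q \<in> set M" for q
    using rc_Comp.IH(1) that by (auto simp: M_def set_zip list_all2_conv_all_nth)
  then show ?case unfolding M(1)
    by (intro derivableI[of rec_rule, OF rec_rule.intros(4)]) (use rc_Comp.IH(2) in \<open>auto simp: M\<close>)
next
  case (rc_PrimRec_0 f xs y g)
  then show ?case by (intro derivableI[of rec_rule, OF rec_rule.intros(5)]) simp
next
  case (rc_PrimRec_Suc f g n xs r y)
  then show ?case by (intro derivableI[of rec_rule, OF rec_rule.intros(6)[of f g n xs y r]]) simp
next
  case (rc_Minim f n xs)
  then obtain m where m: "\<And>i. i < n \<Longrightarrow> derivable rec_rule (f, i # xs, Suc (m i))" by metis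
  define M where "M = map (\<lambda>i. (f, i # xs, Suc (m i))) [0..<n]"
  have "rec_rule (Minim f, xs, n) ((f, n # xs, 0) # M)"
    by (rule rec_rule.intros(7)) (force simp: M_def)
  then show ?case by (rule derivableI[of rec_rule]) (use m rc_Minim.IH in \<open>auto simp: M_def\<close>)
qed

text \<open>Plays the part of a universal program: the program is itself an input, so the function
  symbols of a given formula can be executed.\<close>

lemma semidec_rec_computes [semidec]:
  assumes "computable e" "computable xs" "computable y"
  shows "semidecidable (\<lambda>z. rec_computes (e z) (xs z) (y z))"
proof (rule semidecidable_comp3[OF _ assms])
  show "semidecidable (\<lambda>p. rec_computes (fst p) (fst (snd p)) (snd (snd p)))"
  proof (rule semidecidable_by_rules[where R = rec_rule])
    show "semidecidable (\<lambda>p. rec_rule (fst p) (snd p))"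
      unfolding rec_rule.simps by (intro semidec)
  qed (use rec_rule_sound rec_rule_complete in \<open>auto simp: case_prod_beta\<close>)
qed

section \<open>Rational arithmetic through unreduced fractions\<close>

definition is_fraction :: "rat \<Rightarrow> nat \<Rightarrow> nat \<Rightarrow> nat \<Rightarrow> bool" where
  "is_fraction q m n d \<longleftrightarrow> q * of_nat (Suc d) = of_nat m - of_nat n"

lemma is_fraction_exists: "\<exists>m n d. is_fraction q m n d"
proof -
  obtain i b where q: "quotient_of q = (i, b)" by (metis surj_pair)
  then have b: "b > 0" by (rule quotient_of_denom_pos)
  have "q * of_nat (Suc (nat (b - 1))) = of_int i"
    using b quotient_of_div[OF q] by (simp add: of_nat_nat)
  also have "\<dots> = of_nat (nat i) - of_nat (nat (- i))"
    by (cases "i \<ge> 0") (simp_all add: of_nat_nat)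
  finally show ?thesis unfolding is_fraction_def by blast
qed

text \<open>Writing rationals as (m - n) / Suc d, unreduced, makes their arithmetic one of natural
  numbers. This links such fractions to the codes: u and v are the positive and negative parts of
  the coded numerator, and cross multiplication is rearranged to contain no subtraction.\<close>

lemma semidec_is_fraction [semidec]:
  assumes "computable q" "computable m" "computable n" "computable d"
  shows "semidecidable (\<lambda>z. is_fraction (q z) (m z) (n z) (d z))"
proof -
  have *: "is_fraction q m n d \<longleftrightarrow> (\<exists>a b u v. enc q = prod_encode (a, b) \<and>
    (a = 2 * u \<and> v = 0 \<or> Suc a = 2 * v \<and> u = 0) \<and> u * Suc d + n * b = m * b + v * Suc d)"
    for q m n d
  proof -
    obtain i b where q: "quotient_of q = (i, b)" by (metis surj_pair)
    then have b: "b > 0" by (rule quotient_of_denom_pos)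
    have enc: "enc q = prod_encode (int_encode i, nat b)" by (simp add: enc_rat_def rat_code_def q)
    have int: "int_encode i = 2 * u \<and> v = 0 \<or> Suc (int_encode i) = 2 * v \<and> u = 0 \<longleftrightarrow>
        u = nat i \<and> v = nat (- i)" for u v
      by (cases i rule: int_cases)
        (simp_all add: int_encode_def sum_encode_def nat_add_distrib, presburger+)
    have "is_fraction q m n d \<longleftrightarrow> of_int i * of_nat (Suc d) = ((of_nat m - of_nat n) * of_int b :: rat)"
      unfolding is_fraction_def quotient_of_div[OF q] using b by (simp add: field_simps)
    also have "\<dots> \<longleftrightarrow> (of_int (i * int (Suc d)) :: rat) = of_int ((int m - int n) * b)"
      by simp
    also have "\<dots> \<longleftrightarrow> i * int (Suc d) = (int m - int n) * b" by (simp only: of_int_eq_iff)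
    also have "\<dots> \<longleftrightarrow> int (nat i * Suc d + n * nat b) = int (m * nat b + nat (- i) * Suc d)"
      using b by (cases "i \<ge> 0") (auto simp: algebra_simps)
    finally show ?thesis unfolding enc prod_encode_eq of_nat_eq_iff
      using int by auto
  qed
  show ?thesis unfolding *
    by (intro semidec computable_comp[OF assms(1)] computable_comp[OF assms(2)]
      computable_comp[OF assms(3)] computable_comp[OF assms(4)])
qed

lemma is_fraction_unique: "is_fraction p m n d \<Longrightarrow> is_fraction q m n d \<longleftrightarrow> q = p"
  unfolding is_fraction_def by (metis mult_cancel_right of_nat_eq_0_iff nat.distinct(1))

lemma is_fraction_numerator: "is_fraction q m n d \<Longrightarrow> of_nat m = q * (1 + of_nat d) + of_nat n"
  by (simp add: is_fraction_def)

text \<open>The denominators are stored as predecessors, and d * d' + d + d' is the predecessor of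
  \<open>Suc d * Suc d'\<close>.\<close>

lemma is_fraction_plus:
  assumes "is_fraction p m n d" "is_fraction q m' n' d'"
  shows "is_fraction (p + q) (m * Suc d' + m' * Suc d) (n * Suc d' + n' * Suc d) (d * d' + d + d')"
  by (simp add: is_fraction_def assms[THEN is_fraction_numerator] algebra_simps)

lemma is_fraction_times:
  assumes "is_fraction p m n d" "is_fraction q m' n' d'"
  shows "is_fraction (p * q) (m * m' + n * n') (m * n' + n * m') (d * d' + d + d')"
  by (simp add: is_fraction_def assms[THEN is_fraction_numerator] algebra_simps)

lemma is_fraction_less:
  assumes "is_fraction p m n d" "is_fraction q m' n' d'"
  shows "m * Suc d' + n' * Suc d < m' * Suc d + n * Suc d' \<longleftrightarrow> p < q"
proof -
  define D D' :: rat where "D = 1 + of_nat d" and "D' = 1 + of_nat d'"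
  have pos: "D * D' > 0" by (simp add: D_def D'_def add_pos_nonneg)
  have "m * Suc d' + n' * Suc d < m' * Suc d + n * Suc d' \<longleftrightarrow>
      (of_nat (m * Suc d' + n' * Suc d) :: rat) < of_nat (m' * Suc d + n * Suc d')"
    by (simp only: of_nat_less_iff)
  also have "\<dots> \<longleftrightarrow> (p * D + of_nat n) * D' + of_nat n' * D < (q * D' + of_nat n') * D + of_nat n * D'"
    by (simp add: assms[THEN is_fraction_numerator] D_def D'_def algebra_simps)
  also have "\<dots> \<longleftrightarrow> p * (D * D') < q * (D * D')" by (simp add: algebra_simps)
  also have "\<dots> \<longleftrightarrow> p < q" using pos by (rule mult_less_cancel_right_pos)
  finally show ?thesis .
qed

lemma semidec_rat_plus [semidec]:
  assumes "computable f" "computable g" shows "computable (\<lambda>z. f z + g z :: rat)"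
proof -
  have *: "r = p + q \<longleftrightarrow> (\<exists>m n d m' n' d'. is_fraction p m n d \<and> is_fraction q m' n' d' \<and>
      is_fraction r (m * Suc d' + m' * Suc d) (n * Suc d' + n' * Suc d) (d * d' + d + d'))" for p q r
    using is_fraction_exists[of p] is_fraction_exists[of q] is_fraction_unique[OF is_fraction_plus]
    by blast
  show ?thesis unfolding computable_iff_graph *
    by (intro semidec computable_comp[OF assms(1)] computable_comp[OF assms(2)])
qed

lemma semidec_rat_times [semidec]:
  assumes "computable f" "computable g" shows "computable (\<lambda>z. f z * g z :: rat)"
proof -
  have *: "r = p * q \<longleftrightarrow> (\<exists>m n d m' n' d'. is_fraction p m n d \<and> is_fraction q m' n' d' \<and>
      is_fraction r (m * m' + n * n') (m * n' + n * m') (d * d' + d + d'))" for p q r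
    using is_fraction_exists[of p] is_fraction_exists[of q] is_fraction_unique[OF is_fraction_times]
    by blast
  show ?thesis unfolding computable_iff_graph *
    by (intro semidec computable_comp[OF assms(1)] computable_comp[OF assms(2)])
qed

lemma semidec_rat_less [semidec]:
  assumes "computable f" "computable g" shows "semidecidable (\<lambda>z. f z < (g z :: rat))"
proof -
  have *: "p < q \<longleftrightarrow> (\<exists>m n d m' n' d'. is_fraction p m n d \<and> is_fraction q m' n' d' \<and>
      m * Suc d' + n' * Suc d < m' * Suc d + n * Suc d')" for p q
    using is_fraction_exists[of p] is_fraction_exists[of q] is_fraction_less by blast
  show ?thesis unfolding *
    by (intro semidec computable_comp[OF assms(1)] computable_comp[OF assms(2)])
qed

section \<open>Turing machine runs\<close>

lemma semidec_tl [semidec]: "computable f \<Longrightarrow> computable (\<lambda>z. tl (f z))"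
  using semidec_drop[of "\<lambda>z. Suc 0" f] by (simp add: drop_Suc semidec_const)

lemma semidec_scanned [semidec]:
  assumes "computable f" shows "computable (\<lambda>z. scanned (f z))"
proof -
  have "semidecidable (\<lambda>p. fst p = [] \<and> snd p = 0 \<or> (\<exists>xs. fst p = snd p # xs))" by (intro semidec)
  then have "computable scanned"
    unfolding computable_iff_graph
    by (rule back_subst[of semidecidable]) (auto simp: scanned_def fun_eq_iff split: list.splits)
  then show ?thesis using assms by (rule computable_comp)
qed

lemma semidec_tape_of [semidec]: "computable f \<Longrightarrow> computable (\<lambda>z. tape_of (f z))"
  unfolding tape_of_def by (intro semidec)

text \<open>With one table per direction, a transition is a quadruple of natural numbers and
  \<open>direction\<close> requires no coding.\<close>

lemma finite_transitions:
  assumes "finite (dom M)" shows "finite {(q, a, q', b). M (q, a) = Some (q', b, dir)}"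
proof (rule finite_subset)
  show "{(q, a, q', b). M (q, a) = Some (q', b, dir)} \<subseteq>
      (\<lambda>x. (fst x, snd x, fst (the (M x)), fst (snd (the (M x))))) ` dom M"
    by (force simp: image_iff dom_def)
qed (use assms in simp)

lemma tm_step_eq_Some:
  "tm_step M c = Some c' \<longleftrightarrow> (\<exists>q l r q' b. c = (q, l, r) \<and>
    ((q, scanned r, q', b) \<in> {(q, a, q', b). M (q, a) = Some (q', b, L_move)} \<and>
       c' = (q', tl l, scanned l # b # tl r) \<or>
     (q, scanned r, q', b) \<in> {(q, a, q', b). M (q, a) = Some (q', b, R_move)} \<and>
       c' = (q', b # l, tl r)))"
  by (cases c) (auto split: option.splits direction.splits)

lemma tm_step_eq_None: "tm_step M (q, l, r) = None \<longleftrightarrow> (q, scanned r) \<notin> dom M"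
  by (auto split: option.splits direction.splits)

lemma semidecidable_tm_reaches:
  assumes M: "finite (dom M)"
  shows "semidecidable (\<lambda>p. \<exists>t. tm_reaches M t (fst p) (snd p))"
proof -
  let ?R = "\<lambda>p L. fst p = snd p \<or> (\<exists>c. tm_step M (fst p) = Some c \<and> L = [(c, snd p)])"
  show ?thesis
  proof (rule semidecidable_by_rules[where R = ?R])
    show "semidecidable (\<lambda>p. ?R (fst p) (snd p))"
      unfolding tm_step_eq_Some by (intro semidec finite_transitions[OF M])
  next
    fix p L assume "?R p L" "\<forall>q\<in>set L. \<exists>t. tm_reaches M t (fst q) (snd q)"
    then consider "fst p = snd p" | c t where "tm_step M (fst p) = Some c" "tm_reaches M t c (snd p)"
      by auto
    then show "\<exists>t. tm_reaches M t (fst p) (snd p)"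
    proof cases
      case 1
      then have "tm_reaches M 0 (fst p) (snd p)" by simp
      then show ?thesis ..
    next
      case 2
      then have "tm_reaches M (Suc t) (fst p) (snd p)" by simp
      then show ?thesis ..
    qed
  next
    define R where "R = ?R"
    have "tm_reaches M t c d \<Longrightarrow> derivable R (c, d)" for t c d
    proof (induction t arbitrary: c)
      case 0
      show ?case by (rule derivableI[of R _ "[]"]) (use 0 in \<open>simp_all add: R_def\<close>)
    next
      case (Suc t)
      then obtain c' where "tm_step M c = Some c'" "derivable R (c', d)" by auto
      then show ?case by (intro derivableI[of R _ "[(c', d)]"]) (cases c', simp_all add: R_def)
    qed
    then show "\<exists>t. tm_reaches M t (fst p) (snd p) \<Longrightarrow> derivable ?R p" for p
      unfolding R_def by (cases p) auto
  qed
qed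

text \<open>Permits a search over runs of any length: whichever halting configuration is found is
  the one that carries the output.\<close>

lemma tm_reaches_halting_unique:
  "tm_reaches M t c d \<Longrightarrow> tm_reaches M t' c d' \<Longrightarrow> tm_step M d = None \<Longrightarrow> tm_step M d' = None \<Longrightarrow> d = d'"
proof (induction t arbitrary: c t')
  case 0
  then show ?case by (cases t') auto
next
  case (Suc t)
  then show ?case by (cases t') auto
qed

lemma tape_of_inject: "tape_of v = tape_of w \<longleftrightarrow> v = w"
  unfolding tape_of_def by (intro inj_map_eq_map injI) (auto split: if_splits)

text \<open>The blank is 0 and \<open>tape_of\<close> writes only 1 and 2, so the output ends at the
  first blank or at the end of the list; the right-hand side uses only concatenation.\<close>

lemma takeWhile_eq_tape_of:
  "takeWhile (\<lambda>a. a \<noteq> 0) r = tape_of v \<longleftrightarrow> (\<exists>u. r = tape_of v @ u \<and> (u = [] \<or> (\<exists>u'. u = 0 # u')))"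
proof
  assume *: "takeWhile (\<lambda>a. a \<noteq> 0) r = tape_of v"
  have "r = tape_of v @ dropWhile (\<lambda>a. a \<noteq> 0) r" by (simp flip: *)
  moreover have "dropWhile (\<lambda>a. a \<noteq> 0) r = [] \<or> (\<exists>u'. dropWhile (\<lambda>a. a \<noteq> 0) r = 0 # u')"
    by (induction r) auto
  ultimately show "\<exists>u. r = tape_of v @ u \<and> (u = [] \<or> (\<exists>u'. u = 0 # u'))" by blast
next
  have "\<forall>a\<in>set (tape_of v). a \<noteq> 0" by (auto simp: tape_of_def)
  then show "\<exists>u. r = tape_of v @ u \<and> (u = [] \<or> (\<exists>u'. u = 0 # u')) \<Longrightarrow>
    takeWhile (\<lambda>a. a \<noteq> 0) r = tape_of v"
    by (auto simp: takeWhile_append2)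
qed

text \<open>The graph is enumerated by searching for halting runs. One with the correct output
  exists, and determinism excludes any other output.\<close>

lemma polytime_computable_imp_computable:
  assumes "polytime_computable f" shows "computable f"
proof -
  obtain M c k where M: "finite (dom M)"
    and out: "\<And>w. \<exists>t \<le> c * length w ^ k + c. tm_outputs_in M t w (f w)"
    using assms unfolding polytime_computable_def by blast
  have eq: "v = f w \<longleftrightarrow> (\<exists>q l r. (\<exists>t. tm_reaches M t (0, [], tape_of w) (q, l, r)) \<and>
      (q, scanned r) \<notin> dom M \<and> (\<exists>u. r = tape_of v @ u \<and> (u = [] \<or> (\<exists>u'. u = 0 # u'))))"
    (is "_ \<longleftrightarrow> ?R w v") for v w
  proof -
    have R: "?R w v \<longleftrightarrow> (\<exists>t. tm_outputs_in M t w v)" for v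
      unfolding tm_outputs_in_def tm_step_eq_None takeWhile_eq_tape_of by blast
    have "v = f w" if "tm_outputs_in M t w v" for t
      using out[of w] that unfolding tm_outputs_in_def
      by (metis tm_reaches_halting_unique tape_of_inject prod.inject)
    then show ?thesis unfolding R using out[of w] by blast
  qed
  show ?thesis
    unfolding computable_iff_graph eq
    by (intro semidec M semidecidable_comp2[OF semidecidable_tm_reaches[OF M]])
qed

section \<open>Certificates by interval arithmetic\<close>

text \<open>The condition on the prefix A makes the first entry count, so an interval prepended for
  a quantified variable shadows an older one.\<close>

lemma semidec_map_of [semidec]:
  fixes J :: "'a::enc \<Rightarrow> ('b::enc \<times> 'c::enc) list"
  assumes "computable J" "computable v" "computable K"
  shows "semidecidable (\<lambda>z. map_of (J z) (v z) = Some (K z))"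
proof -
  have *: "map_of J v = Some K \<longleftrightarrow> (\<exists>A B. J = A @ (v, K) # B \<and> (\<forall>p\<in>set A. fst p \<noteq> v))"
    for J :: "('b \<times> 'c) list" and v K
  proof
    assume "map_of J v = Some K"
    then show "\<exists>A B. J = A @ (v, K) # B \<and> (\<forall>p\<in>set A. fst p \<noteq> v)"
    proof (induction J)
      case (Cons p J)
      show ?case
      proof (cases "fst p = v")
        case True
        then have "p # J = [] @ (v, K) # J" using Cons.prems by (cases p) simp
        then show ?thesis by fastforce
      next
        case False
        then obtain A B where "J = A @ (v, K) # B" "\<forall>p\<in>set A. fst p \<noteq> v"
          using Cons by (cases p) auto
        then show ?thesis using False by (intro exI[of _ "p # A"] exI[of _ B]) simp
      qed
    qed simp
  next
    assume "\<exists>A B. J = A @ (v, K) # B \<and> (\<forall>p\<in>set A. fst p \<noteq> v)"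
    then obtain A B where J: "J = A @ (v, K) # B" and "\<forall>p\<in>set A. fst p \<noteq> v" by blast
    then have "map_of A v = None" by (auto simp: map_of_eq_None_iff)
    then show "map_of J v = Some K" by (simp add: J map_add_def)
  qed
  show ?thesis unfolding *
    by (intro semidec computable_comp[OF assms(1)] computable_comp[OF assms(2)]
      computable_comp[OF assms(3)])
qed

lemma semidec_rat_pair_code [semidec]: "computable f \<Longrightarrow> computable (\<lambda>z. rat_pair_code (f z))"
  by (rule semidec_enc_preserving) (simp add: rat_pair_code_def enc_prod_def enc_rat_def)

type_synonym box = "(nat \<times> rat \<times> rat) list"

text \<open>
  The rule for products leaves some slack between \<open>(l, h)\<close> and the range of the product, so that no
  minima and maxima have to be formed.
\<close>

inductive term_rule :: "ecf_term \<times> box \<times> rat \<times> rat \<Rightarrow> (ecf_term \<times> box \<times> rat \<times> rat) list \<Rightarrow> bool" where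
  "map_of J v = Some K \<Longrightarrow> term_rule (Var v, J, K) []"
| "a < 0 \<Longrightarrow> 0 < b \<Longrightarrow> term_rule (Const0, J, a, b) []"
| "a < 1 \<Longrightarrow> 1 < b \<Longrightarrow> term_rule (Const1, J, a, b) []"
| "term_rule (Plus t u, J, a + c, b + d) [(t, J, a, b), (u, J, c, d)]"
| "l < a * c \<Longrightarrow> l < a * d \<Longrightarrow> l < b * c \<Longrightarrow> l < b * d \<Longrightarrow>
   a * c < h \<Longrightarrow> a * d < h \<Longrightarrow> b * c < h \<Longrightarrow> b * d < h \<Longrightarrow>
   term_rule (Times t u, J, l, h) [(t, J, a, b), (u, J, c, d)]"
| "rec_computes e (map (\<lambda>q. rat_pair_code (snd q)) M) (rat_pair_code K) \<Longrightarrow>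
   term_rule (App e (map fst M), J, K) (map (\<lambda>q. (fst q, J, snd q)) M)"

text \<open>Term derivations are a semidecidable side condition of the rule for \<open>Less\<close>,
  since their judgements have another type. The rule for \<open>Exists\<close> asks only for a
  nonempty interval: its premise will hold on the whole enlarged box.\<close>

inductive formula_rule :: "ex_formula \<times> box \<Rightarrow> (ex_formula \<times> box) list \<Rightarrow> bool" where
  "derivable term_rule (t, J, a, b) \<Longrightarrow> derivable term_rule (u, J, c, d) \<Longrightarrow> b < c \<Longrightarrow>
   formula_rule (Less t u, J) []"
| "formula_rule (Conj \<phi> \<psi>, J) [(\<phi>, J), (\<psi>, J)]"
| "formula_rule (Disj \<phi> \<psi>, J) [(\<phi>, J)]"
| "formula_rule (Disj \<phi> \<psi>, J) [(\<psi>, J)]"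
| "a < b \<Longrightarrow> formula_rule (Exists v \<phi>, J) [(\<phi>, (v, a, b) # J)]"

lemma semidecidable_term_rule: "semidecidable (derivable term_rule)"
  by (rule semidecidable_derivable) (unfold term_rule.simps, intro semidec)

lemma semidecidable_formula_rule: "semidecidable (derivable formula_rule)"
  by (rule semidecidable_derivable)
    (unfold formula_rule.simps, intro semidec semidecidable_comp[OF semidecidable_term_rule])

section \<open>Soundness of the certificates\<close>

definition encloses :: "box \<Rightarrow> (nat \<Rightarrow> real) \<Rightarrow> bool" where
  "encloses J s \<longleftrightarrow> (\<forall>v K. map_of J v = Some K \<longrightarrow> s v \<in> interval K)"

text \<open>A product is affine in each factor, so its extremes over a box are attained at corners.
  First y is moved to an endpoint with x fixed, then x.\<close>

lemma product_between:
  fixes a b c d x y l h :: real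
  assumes "a < x" "x < b" "c < y" "y < d"
    and "l < a * c" "l < a * d" "l < b * c" "l < b * d"
    and "a * c < h" "a * d < h" "b * c < h" "b * d < h"
  shows "l < x * y \<and> x * y < h"
proof -
  have between: "min (p * u) (p * v) \<le> p * z \<and> p * z \<le> max (p * u) (p * v)"
    if "u < z" "z < v" for p u v z :: real
    using that by (cases "p \<ge> 0") (auto simp: min_def max_def mult_le_cancel_left)
  show ?thesis
    using between[OF assms(3,4), of x] between[OF assms(1,2), of c] between[OF assms(1,2), of d] assms(5-)
    by (simp add: mult.commute min_def max_def split: if_splits)
qed

text \<open>In an application, determinism of programs forces the computed interval to be the one
  that \<open>ecf_code\<close> promises for the argument intervals, and that interval contains the
  value.\<close>

lemma derivable_term_sound:
  "derivable term_rule (t, J, K) \<Longrightarrow> term_over_ECF t \<Longrightarrow> encloses J s \<Longrightarrow> term_value s t \<in> interval K"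
proof (induction "(t, J, K)" arbitrary: t J K rule: derivable.induct)
  case (derivableI L)
  from derivableI.hyps(1) show ?case
  proof cases
    case (1 v)
    then have "s v \<in> interval K" using derivableI.prems(2) unfolding encloses_def by blast
    then show ?thesis by (simp add: 1)
  next
    case (2 a b)
    then show ?thesis by (simp add: interval_def)
  next
    case (3 a b)
    then show ?thesis by (simp add: interval_def)
  next
    case (4 t u a c b d)
    then have "term_value s t \<in> interval (a, b)" "term_value s u \<in> interval (c, d)"
      using derivableI by auto
    then show ?thesis by (simp add: 4 interval_def of_rat_add)
  next
    case (5 l a c d b h t u)
    then have *: "term_value s t \<in> interval (a, b)" "term_value s u \<in> interval (c, d)"
      using derivableI by auto
    have less: "(real_of_rat p < real_of_rat q * real_of_rat r) = (p < q * r)"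
      "(real_of_rat q * real_of_rat r < real_of_rat p) = (q * r < p)" for p q r
      by (simp_all add: of_rat_less flip: of_rat_mult)
    show ?thesis
      using product_between[of "real_of_rat a" "term_value s t" "real_of_rat b" "real_of_rat c"
          "term_value s u" "real_of_rat d" "real_of_rat l" "real_of_rat h"] * 5
      by (simp add: interval_def less)
  next
    case (6 e M)
    define Ks where "Ks = map snd M"
    define xs where "xs = map (\<lambda>q. term_value s (fst q)) M"
    have val: "term_value s (fst q) \<in> interval (snd q)" if "q \<in> set M" for q
      using derivableI 6 that by (cases "snd q") (auto simp: list_all_iff)
    \<comment> \<open>The program is specified only for pairs a < b; an interval that contains the
      value of an argument is such a pair.\<close>
    have Ks: "Ks \<in> rat_intervals (length M)"
    proof -
      have "fst (snd q) < snd (snd q)" if "q \<in> set M" for q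
        using val[OF that] of_rat_less[of "fst (snd q)" "snd (snd q)", where 'a = real]
        by (auto simp: interval_def)
      then show ?thesis by (auto simp: rat_intervals_def Ks_def)
    qed
    have box: "xs \<in> box_of Ks" using val
      by (auto simp: box_of_def xs_def Ks_def list_all2_conv_all_nth)
    obtain f g where f: "ecf_code (length M) e f" and
      g: "\<And>J. J \<in> rat_intervals (length M) \<Longrightarrow>
        rec_computes e (map rat_pair_code J) (rat_pair_code (g J))"
      "effectively_approximates (length M) g f"
      using derivableI.prems(1) 6 by (auto simp: ecf_code_def)
    have "rec_computes e (map rat_pair_code Ks) (rat_pair_code K)"
      using 6 by (simp add: Ks_def comp_def)
    then have "K = g Ks"
      using rec_computes_unique[OF g(1)[OF Ks]] injD[OF inj_rat_pair_code] by metis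
    moreover have "f xs \<in> interval (g Ks)" using g(2) Ks box
      by (simp add: effectively_approximates_def)
    moreover have "term_value s t = f xs"
      using ecf_fun_eq[OF f, of xs] 6 by (simp add: xs_def comp_def)
    ultimately show ?thesis by simp
  qed
qed

lemma derivable_formula_sound:
  "derivable formula_rule (\<phi>, J) \<Longrightarrow> over_ECF \<phi> \<Longrightarrow> encloses J s \<Longrightarrow> satisfies s \<phi>"
proof (induction "(\<phi>, J)" arbitrary: \<phi> J s rule: derivable.induct)
  case (derivableI L)
  from derivableI.hyps(1) show ?case
  proof cases
    case (1 t a b u c d)
    then have "term_value s t \<in> interval (a, b)" "term_value s u \<in> interval (c, d)"
      using derivableI.prems by (auto intro: derivable_term_sound)
    moreover have "real_of_rat b < real_of_rat c" using 1 by (simp add: of_rat_less)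
    ultimately show ?thesis by (simp add: 1 interval_def)
  next
    case (5 a b v \<psi>)
    \<comment> \<open>Any point of the interval is a witness, because the induction hypothesis
      covers every assignment enclosed by the box.\<close>
    obtain x where x: "real_of_rat a < x" "x < real_of_rat b"
      using 5 dense[of "real_of_rat a" "real_of_rat b"] by (auto simp: of_rat_less)
    have "encloses ((v, a, b) # J) (s(v := x))"
      using derivableI.prems(2) x by (auto simp: encloses_def interval_def)
    then have "satisfies (s(v := x)) \<psi>" using derivableI 5 by auto
    then show ?thesis by (auto simp: 5)
  qed (use derivableI in auto)
qed

section \<open>Completeness of the certificates\<close>

definition fine :: "(nat \<Rightarrow> real) \<Rightarrow> nat set \<Rightarrow> real \<Rightarrow> box \<Rightarrow> bool" where
  "fine s V \<delta> J \<longleftrightarrow> (\<forall>v\<in>V. \<exists>K. map_of J v = Some K \<and> s v \<in> interval K \<and> width K < \<delta>)"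

lemma fine_subset: "fine s V \<delta> J \<Longrightarrow> U \<subseteq> V \<Longrightarrow> fine s U \<delta> J"
  unfolding fine_def by blast

lemma fine_Un: "fine s (U \<union> V) \<delta> J \<longleftrightarrow> fine s U \<delta> J \<and> fine s V \<delta> J"
  unfolding fine_def by blast

lemma in_interval_close:
  assumes "x \<in> interval K"
  shows "\<bar>real_of_rat (fst K) - x\<bar> < width K" "\<bar>real_of_rat (snd K) - x\<bar> < width K"
    and "y \<in> interval K \<Longrightarrow> \<bar>y - x\<bar> < width K"
  using assms by (auto simp: interval_def width_def)

lemma product_close:
  fixes u v x y :: real
  assumes "\<bar>u - x\<bar> < \<eta>" "\<bar>v - y\<bar> < \<eta>" "\<eta> \<le> 1"
  shows "\<bar>u * v - x * y\<bar> \<le> \<eta> * (\<bar>x\<bar> + \<bar>y\<bar> + 1)"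
proof -
  have "u * v - x * y = (u - x) * v + x * (v - y)" by (simp add: algebra_simps)
  also have "\<bar>\<dots>\<bar> \<le> \<bar>u - x\<bar> * \<bar>v\<bar> + \<bar>x\<bar> * \<bar>v - y\<bar>"
    by (metis abs_mult abs_triangle_ineq)
  also have "\<dots> \<le> \<eta> * (\<bar>y\<bar> + 1) + \<bar>x\<bar> * \<eta>"
    using assms by (intro add_mono mult_mono) auto
  finally show ?thesis by (simp add: algebra_simps)
qed

text \<open>The quantification over all boxes of mesh \<delta>, rather than over some box, is what
  lets the subterms of a term be evaluated over a common box.\<close>

definition resolves :: "(nat \<Rightarrow> real) \<Rightarrow> real \<Rightarrow> real \<Rightarrow> ecf_term \<Rightarrow> bool" where
  "resolves s \<epsilon> \<delta> t \<longleftrightarrow> (\<forall>J. fine s (term_vars t) \<delta> J \<longrightarrow>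
    (\<exists>K. derivable term_rule (t, J, K) \<and> term_value s t \<in> interval K \<and> width K < \<epsilon>))"

lemma resolvesI:
  "(\<And>J. fine s (term_vars t) \<delta> J \<Longrightarrow>
    \<exists>K. derivable term_rule (t, J, K) \<and> term_value s t \<in> interval K \<and> width K < \<epsilon>) \<Longrightarrow>
      resolves s \<epsilon> \<delta> t"
  unfolding resolves_def by blast

lemma resolvesE:
  assumes "resolves s \<epsilon> \<delta> t" "fine s V \<delta> J" "term_vars t \<subseteq> V"
  obtains a b where "derivable term_rule (t, J, a, b)" "term_value s t \<in> interval (a, b)" "width (a, b) < \<epsilon>"
  using assms fine_subset unfolding resolves_def by (metis surj_pair)

text \<open>The accuracy demanded of the arguments is the modulus of continuity of g for \<epsilon>,
  which is uniform only on a bounded cube; the cube therefore has to be fixed before the argument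
  intervals are known.\<close>

lemma resolves_App:
  assumes f: "ecf_code (length ts) e f" and \<epsilon>: "\<epsilon> > 0"
    and ts: "\<And>t \<epsilon>. t \<in> set ts \<Longrightarrow> \<epsilon> > 0 \<Longrightarrow> \<forall>\<^sub>F \<delta> in at_right 0. resolves s \<epsilon> \<delta> t"
  shows "\<forall>\<^sub>F \<delta> in at_right 0. resolves s \<epsilon> \<delta> (App e ts)"
proof -
  obtain g where g: "\<And>J. J \<in> rat_intervals (length ts) \<Longrightarrow>
    rec_computes e (map rat_pair_code J) (rat_pair_code (g J))"
    and g_f: "effectively_approximates (length ts) g f"
    using f by (auto simp: ecf_code_def)
  \<comment> \<open>The summand 1 leaves room around the values: argument intervals narrower than 1
    stay inside [-M, M]. Hence the accuracy \<open>min \<eta> 1\<close> below.\<close>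
  define M where "M = (\<Sum>t\<in>set ts. \<bar>term_value s t\<bar>) + 1"
  have M: "\<bar>term_value s t\<bar> + 1 \<le> M" if "t \<in> set ts" for t
    unfolding M_def using that by (auto intro: member_le_sum)
  have "M > 0" unfolding M_def by (intro add_nonneg_pos sum_nonneg) auto
  then have "\<exists>\<delta>>0. \<forall>J \<in> rat_intervals (length ts).
      (\<forall>K \<in> set J. interval K \<subseteq> {-M..M} \<and> width K < \<delta>) \<longrightarrow> width (g J) < \<epsilon>"
    using g_f \<epsilon> unfolding effectively_approximates_def by simp
  then obtain \<eta> where \<eta>: "\<eta> > 0" and small: "\<And>J. J \<in> rat_intervals (length ts) \<Longrightarrow>
      \<forall>K \<in> set J. interval K \<subseteq> {-M..M} \<and> width K < \<eta> \<Longrightarrow> width (g J) < \<epsilon>"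
    by blast
  have "\<forall>\<^sub>F \<delta> in at_right 0. \<forall>t\<in>set ts. resolves s (min \<eta> 1) \<delta> t"
    using ts \<eta> by (intro eventually_ball_finite) auto
  then show ?thesis
  proof (rule eventually_mono, intro resolvesI)
    fix \<delta> J
    assume all: "\<forall>t\<in>set ts. resolves s (min \<eta> 1) \<delta> t" and fine: "fine s (term_vars (App e ts)) \<delta> J"
    have "\<exists>K. derivable term_rule (t, J, K) \<and> term_value s t \<in> interval K \<and> width K < min \<eta> 1"
      if "t \<in> set ts" for t
    proof -
      have "term_vars t \<subseteq> term_vars (App e ts)" using that by auto
      then show ?thesis using all that fine by (meson resolvesE)
    qed
    then obtain K where K: "\<And>t. t \<in> set ts \<Longrightarrow> derivable term_rule (t, J, K t)"
      "\<And>t. t \<in> set ts \<Longrightarrow> term_value s t \<in> interval (K t)" "\<And>t. t \<in> set ts \<Longrightarrow> width (K t) < min \<eta> 1"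
      by metis
    define Ks where "Ks = map K ts"
    have Ks: "Ks \<in> rat_intervals (length ts)"
    proof -
      have "fst (K t) < snd (K t)" if "t \<in> set ts" for t
        using K(2)[OF that] of_rat_less[of "fst (K t)" "snd (K t)", where 'a = real]
        by (auto simp: interval_def)
      then show ?thesis by (auto simp: rat_intervals_def Ks_def case_prod_beta)
    qed
    have "interval (K t) \<subseteq> {-M..M}" if "t \<in> set ts" for t
      using in_interval_close(3)[OF K(2)[OF that]] K(3)[OF that] M[OF that] by force
    then have "width (g Ks) < \<epsilon>" using K(3) by (intro small Ks) (auto simp: Ks_def)
    moreover have "f (map (term_value s) ts) \<in> interval (g Ks)"
      using g_f Ks K(2)
        by (auto simp: effectively_approximates_def box_of_def Ks_def list_all2_conv_all_nth)
    moreover have "derivable term_rule (App e ts, J, g Ks)"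
    proof -
      define N where "N = map (\<lambda>t. (t, K t)) ts"
      have "map fst N = ts" "map (\<lambda>q. rat_pair_code (snd q)) N = map rat_pair_code Ks"
        by (simp_all add: N_def Ks_def comp_def)
      then have "term_rule (App e ts, J, g Ks) (map (\<lambda>q. (fst q, J, snd q)) N)"
        using term_rule.intros(6)[of e N "g Ks" J] g[OF Ks] by simp
      then show ?thesis by (rule derivableI[of term_rule]) (use K(1) in \<open>auto simp: N_def\<close>)
    qed
    ultimately show "\<exists>K. derivable term_rule (App e ts, J, K) \<and>
        term_value s (App e ts) \<in> interval K \<and> width K < \<epsilon>"
      using ecf_fun_eq[OF f] by (intro exI[of _ "g Ks"]) auto
  qed
qed

text \<open>The thresholds for \<delta> are hidden in the filter \<open>at_right 0\<close>, so those
  of finitely many subterms combine without explicit minima.\<close>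

lemma derivable_term_complete:
  assumes "term_over_ECF t" "\<epsilon> > 0"
  shows "\<forall>\<^sub>F \<delta> in at_right 0. resolves s \<epsilon> \<delta> t"
  using assms
proof (induction t arbitrary: \<epsilon>)
  case (Var v)
  have "resolves s \<epsilon> \<delta> (Var v)" if "\<delta> < \<epsilon>" for \<delta>
  proof (rule resolvesI)
    fix J assume "fine s (term_vars (Var v)) \<delta> J"
    then obtain K where K: "map_of J v = Some K" "s v \<in> interval K" "width K < \<delta>"
      by (auto simp: fine_def)
    then have "derivable term_rule (Var v, J, K)"
      by (intro derivableI[of term_rule, OF term_rule.intros(1)]) auto
    then show "\<exists>K. derivable term_rule (Var v, J, K) \<and> term_value s (Var v) \<in> interval K \<and> width K < \<epsilon>"
      using K that by (intro exI[of _ K]) auto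
  qed
  then show ?case using Var.prems(2) unfolding eventually_at_right_field by blast
next
  case Const0
  obtain a b where "a < b" "0 \<in> interval (a, b)" "width (a, b) < \<epsilon>"
    using small_rat_interval[OF Const0(2), of 0] by metis
  moreover from this have "derivable term_rule (Const0, J, a, b)" for J
    by (intro derivableI[of term_rule, OF term_rule.intros(2)]) (auto simp: interval_def)
  ultimately show ?case by (intro always_eventually allI resolvesI exI[of _ "(a, b)"]) simp
next
  case Const1
  obtain a b where "a < b" "1 \<in> interval (a, b)" "width (a, b) < \<epsilon>"
    using small_rat_interval[OF Const1(2), of 1] by metis
  moreover from this have "derivable term_rule (Const1, J, a, b)" for J
    by (intro derivableI[of term_rule, OF term_rule.intros(3)]) (auto simp: interval_def)
  ultimately show ?case by (intro always_eventually allI resolvesI exI[of _ "(a, b)"]) simp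
next
  case (Plus t u)
  have "\<forall>\<^sub>F \<delta> in at_right 0. resolves s (\<epsilon> / 2) \<delta> t \<and> resolves s (\<epsilon> / 2) \<delta> u"
    using Plus by (intro eventually_conj) auto
  then show ?case
  proof (rule eventually_mono, intro resolvesI)
    fix \<delta> J
    assume "resolves s (\<epsilon> / 2) \<delta> t \<and> resolves s (\<epsilon> / 2) \<delta> u"
      and fine: "fine s (term_vars (Plus t u)) \<delta> J"
    then have t: "resolves s (\<epsilon> / 2) \<delta> t" and u: "resolves s (\<epsilon> / 2) \<delta> u" by auto
    obtain a b where ab: "derivable term_rule (t, J, a, b)" "term_value s t \<in> interval (a, b)"
      "width (a, b) < \<epsilon> / 2"
      by (rule resolvesE[OF t fine]) auto
    obtain c d where cd: "derivable term_rule (u, J, c, d)" "term_value s u \<in> interval (c, d)"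
      "width (c, d) < \<epsilon> / 2"
      by (rule resolvesE[OF u fine]) auto
    have "derivable term_rule (Plus t u, J, a + c, b + d)"
      by (rule derivableI[of term_rule, OF term_rule.intros(4)]) (use ab cd in auto)
    moreover have "term_value s (Plus t u) \<in> interval (a + c, b + d) \<and> width (a + c, b + d) < \<epsilon>"
      using ab cd by (auto simp: interval_def width_def of_rat_add)
    ultimately show "\<exists>K. derivable term_rule (Plus t u, J, K) \<and>
        term_value s (Plus t u) \<in> interval K \<and> width K < \<epsilon>" by blast
  qed
next
  case (Times t u)
  define x y where "x = term_value s t" and "y = term_value s u"
  \<comment> \<open>By \<open>product_close\<close>, factors within \<eta> of x and y have a product
    within \<epsilon> / 8 of x * y, and so strictly within \<epsilon> / 4. The bound 1 is the one
    required there to estimate a perturbed factor.\<close>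
  define \<eta> where "\<eta> = min 1 (\<epsilon> / (8 * (\<bar>x\<bar> + \<bar>y\<bar> + 1)))"
  have pos: "\<bar>x\<bar> + \<bar>y\<bar> + 1 > 0" by simp
  have \<eta>: "\<eta> > 0" "\<eta> \<le> 1" using Times.prems pos by (auto simp: \<eta>_def)
  have "\<eta> * (\<bar>x\<bar> + \<bar>y\<bar> + 1) \<le> \<epsilon> / (8 * (\<bar>x\<bar> + \<bar>y\<bar> + 1)) * (\<bar>x\<bar> + \<bar>y\<bar> + 1)"
    using pos by (intro mult_right_mono) (auto simp: \<eta>_def)
  also have "\<dots> = \<epsilon> / 8" using pos by (simp add: field_simps)
  finally have \<eta>_small: "\<eta> * (\<bar>x\<bar> + \<bar>y\<bar> + 1) < \<epsilon> / 4" using Times.prems by simp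
  \<comment> \<open>The endpoints lie between \<epsilon> / 4 and \<epsilon> / 2 away from x * y: far
    enough to leave all four corner products strictly inside, and close enough for a width below
    \<epsilon>.\<close>
  obtain l where l: "x * y - \<epsilon> / 2 < real_of_rat l" "real_of_rat l < x * y - \<epsilon> / 4"
    using of_rat_dense[of "x * y - \<epsilon> / 2" "x * y - \<epsilon> / 4"] Times.prems by auto
  obtain h where h: "x * y + \<epsilon> / 4 < real_of_rat h" "real_of_rat h < x * y + \<epsilon> / 2"
    using of_rat_dense[of "x * y + \<epsilon> / 4" "x * y + \<epsilon> / 2"] Times.prems by auto
  have lh: "x * y \<in> interval (l, h)" "width (l, h) < \<epsilon>"
    using l h Times.prems by (auto simp: interval_def width_def)
  have close: "l < p * q \<and> p * q < h"
    if "\<bar>real_of_rat p - x\<bar> < \<eta>" "\<bar>real_of_rat q - y\<bar> < \<eta>" for p q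
  proof -
    have "\<bar>real_of_rat (p * q) - x * y\<bar> < \<epsilon> / 4"
      using product_close[OF that \<eta>(2)] \<eta>_small by (simp add: of_rat_mult)
    then have "real_of_rat l < real_of_rat (p * q)" "real_of_rat (p * q) < real_of_rat h"
      using l h by linarith+
    then show ?thesis by (simp only: of_rat_less)
  qed
  have "\<forall>\<^sub>F \<delta> in at_right 0. resolves s \<eta> \<delta> t \<and> resolves s \<eta> \<delta> u"
    using Times \<eta> by (intro eventually_conj) auto
  then show ?case
  proof (rule eventually_mono, intro resolvesI)
    fix \<delta> J
    assume "resolves s \<eta> \<delta> t \<and> resolves s \<eta> \<delta> u" and fine: "fine s (term_vars (Times t u)) \<delta> J"
    then have t: "resolves s \<eta> \<delta> t" and u: "resolves s \<eta> \<delta> u" by auto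
    obtain a b where ab: "derivable term_rule (t, J, a, b)" "x \<in> interval (a, b)" "width (a, b) < \<eta>"
      unfolding x_def by (rule resolvesE[OF t fine]) auto
    obtain c d where cd: "derivable term_rule (u, J, c, d)" "y \<in> interval (c, d)" "width (c, d) < \<eta>"
      unfolding y_def by (rule resolvesE[OF u fine]) auto
    have near: "\<bar>real_of_rat a - x\<bar> < \<eta>" "\<bar>real_of_rat b - x\<bar> < \<eta>"
      "\<bar>real_of_rat c - y\<bar> < \<eta>" "\<bar>real_of_rat d - y\<bar> < \<eta>"
      using in_interval_close(1,2)[OF ab(2)] ab(3) in_interval_close(1,2)[OF cd(2)] cd(3) by auto
    have "term_rule (Times t u, J, l, h) [(t, J, a, b), (u, J, c, d)]"
      using close near by (intro term_rule.intros(5)) auto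
    then have "derivable term_rule (Times t u, J, l, h)"
      by (rule derivableI[of term_rule]) (use ab cd in auto)
    then show "\<exists>K. derivable term_rule (Times t u, J, K) \<and>
        term_value s (Times t u) \<in> interval K \<and> width K < \<epsilon>"
      using lh by (auto simp: x_def y_def)
  qed
next
  case (App e ts)
  then obtain f where "ecf_code (length ts) e f" by auto
  then show ?case
    using App by (intro resolves_App) (auto simp: list_all_iff)
qed

text \<open>For an equality-free formula, truth at s rests on finitely many strict inequalities,
  each with a positive gap that a sufficiently fine box resolves.\<close>

lemma derivable_formula_complete:
  assumes "over_ECF \<phi>" "equality_free \<phi>" "satisfies s \<phi>"
  shows "\<forall>\<^sub>F \<delta> in at_right 0. \<forall>J. fine s (free_vars \<phi>) \<delta> J \<longrightarrow> derivable formula_rule (\<phi>, J)"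
  using assms
proof (induction \<phi> arbitrary: s)
  case (Less t u)
  \<comment> \<open>Half the gap: the two values are 2 * \<epsilon> apart, so intervals around them
    of width below \<epsilon> are disjoint and in the right order.\<close>
  define \<epsilon> where "\<epsilon> = (term_value s u - term_value s t) / 2"
  have "\<epsilon> > 0" using Less by (simp add: \<epsilon>_def)
  then have "\<forall>\<^sub>F \<delta> in at_right 0. resolves s \<epsilon> \<delta> t \<and> resolves s \<epsilon> \<delta> u"
    using Less by (intro eventually_conj derivable_term_complete) auto
  then show ?case
  proof (rule eventually_mono, intro allI impI)
    fix \<delta> J
    assume "resolves s \<epsilon> \<delta> t \<and> resolves s \<epsilon> \<delta> u" and fine: "fine s (free_vars (Less t u)) \<delta> J"
    then have t: "resolves s \<epsilon> \<delta> t" and u: "resolves s \<epsilon> \<delta> u" by auto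
    obtain a b where ab: "derivable term_rule (t, J, a, b)" "term_value s t \<in> interval (a, b)"
      "width (a, b) < \<epsilon>"
      by (rule resolvesE[OF t fine]) auto
    obtain c d where cd: "derivable term_rule (u, J, c, d)" "term_value s u \<in> interval (c, d)"
      "width (c, d) < \<epsilon>"
      by (rule resolvesE[OF u fine]) auto
    have "term_value s u - term_value s t = 2 * \<epsilon>" by (simp add: \<epsilon>_def)
    then have "real_of_rat b < real_of_rat c"
      using in_interval_close(2)[OF ab(2)] ab(3) in_interval_close(1)[OF cd(2)] cd(3) by simp
    then have "b < c" by (simp only: of_rat_less)
    then show "derivable formula_rule (Less t u, J)"
      by (rule derivableI[of formula_rule, OF formula_rule.intros(1)[OF ab(1) cd(1)]]) simp
  qed
next
  case (Conj \<phi> \<psi>)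
  then have "\<forall>\<^sub>F \<delta> in at_right 0. (\<forall>J. fine s (free_vars \<phi>) \<delta> J \<longrightarrow> derivable formula_rule (\<phi>, J)) \<and>
      (\<forall>J. fine s (free_vars \<psi>) \<delta> J \<longrightarrow> derivable formula_rule (\<psi>, J))"
    by (intro eventually_conj) auto
  then show ?case
    by (rule eventually_mono)
      (auto intro!: derivableI[of formula_rule, OF formula_rule.intros(2)] simp: fine_Un)
next
  case (Disj \<phi> \<psi>)
  from Disj.prems consider "satisfies s \<phi>" | "satisfies s \<psi>" by auto
  then show ?case
  proof cases
    case 1
    then have "\<forall>\<^sub>F \<delta> in at_right 0. \<forall>J. fine s (free_vars \<phi>) \<delta> J \<longrightarrow> derivable formula_rule (\<phi>, J)"
      using Disj by auto
    then show ?thesis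
      by (rule eventually_mono)
        (auto intro!: derivableI[of formula_rule, OF formula_rule.intros(3)] simp: fine_Un)
  next
    case 2
    then have "\<forall>\<^sub>F \<delta> in at_right 0. \<forall>J. fine s (free_vars \<psi>) \<delta> J \<longrightarrow> derivable formula_rule (\<psi>, J)"
      using Disj by auto
    then show ?thesis
      by (rule eventually_mono)
        (auto intro!: derivableI[of formula_rule, OF formula_rule.intros(4)] simp: fine_Un)
  qed
next
  case (Exists v \<phi>)
  then obtain x where "satisfies (s(v := x)) \<phi>" by auto
  then have "\<forall>\<^sub>F \<delta> in at_right 0. (\<forall>J. fine (s(v := x)) (free_vars \<phi>) \<delta> J \<longrightarrow>
      derivable formula_rule (\<phi>, J)) \<and> 0 < \<delta>"
    using Exists by (intro eventually_conj eventually_at_right_less) auto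
  then show ?case
  proof (rule eventually_mono, intro allI impI)
    fix \<delta> J
    assume *: "(\<forall>J. fine (s(v := x)) (free_vars \<phi>) \<delta> J \<longrightarrow> derivable formula_rule (\<phi>, J)) \<and> 0 < \<delta>"
      and fine: "fine s (free_vars (Exists v \<phi>)) \<delta> J"
    \<comment> \<open>The real witness x is replaced by a rational interval around it, no wider than
      the mesh of the given box; this is where \<delta> > 0 enters.\<close>
    then obtain a b where ab: "a < b" "x \<in> interval (a, b)" "width (a, b) < \<delta>"
      using small_rat_interval[of \<delta> x] by metis
    have "fine (s(v := x)) (free_vars \<phi>) \<delta> ((v, a, b) # J)"
      using fine ab by (auto simp: fine_def)
    then have "derivable formula_rule (\<phi>, (v, a, b) # J)" using * by blast
    then show "derivable formula_rule (Exists v \<phi>, J)"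
      by (intro derivableI[of formula_rule, OF formula_rule.intros(5)[OF ab(1)]]) simp
  qed
qed simp

text \<open>Each entry (a, v, K) of \<open>M\<close> ties a parameter a and its variable v to an
  interval K around a. Rational parameters are thus enclosed just like real witnesses, and the
  right-hand side is semidecidable in \<open>as\<close>.\<close>

lemma holds_at_iff_derivable:
  assumes \<phi>: "over_ECF \<phi>" "equality_free \<phi>" and vs: "free_vars \<phi> \<subseteq> set vs"
  shows "length as = length vs \<and> holds_at \<phi> vs as \<longleftrightarrow>
    (\<exists>M. map fst M = as \<and> map (\<lambda>q. fst (snd q)) M = vs \<and>
      (\<forall>q\<in>set M. fst (snd (snd q)) < fst q \<and> fst q < snd (snd (snd q))) \<and>
      derivable formula_rule (\<phi>, map snd M))" (is "?L \<longleftrightarrow> ?R")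
proof
  assume L: ?L
  then have "\<forall>\<^sub>F \<delta> in at_right 0. (\<forall>J. fine (assignment vs as) (free_vars \<phi>) \<delta> J \<longrightarrow>
      derivable formula_rule (\<phi>, J)) \<and> 0 < \<delta>"
    using \<phi> by (intro eventually_conj eventually_at_right_less derivable_formula_complete)
      (auto simp: holds_at_def)
  then obtain \<delta> where \<delta>: "\<And>J. fine (assignment vs as) (free_vars \<phi>) \<delta> J \<Longrightarrow>
    derivable formula_rule (\<phi>, J)"
    "\<delta> > 0"
    using eventually_happens'[of "at_right (0::real)"] by (auto simp: trivial_limit_at_right_real)
  have "\<exists>K. real_of_rat a \<in> interval K \<and> width K < \<delta>" for a
    using small_rat_interval[OF \<delta>(2), of "real_of_rat a"] by metis
  then obtain K where K: "\<And>a. real_of_rat a \<in> interval (K a)" "\<And>a. width (K a) < \<delta>" by metis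
  define M where "M = map (\<lambda>(v, a). (a, v, K a)) (zip vs as)"
  have snd_M: "map snd M = map (\<lambda>(v, a). (v, K a)) (zip vs as)"
    by (simp add: M_def case_prod_beta comp_def)
  have "fine (assignment vs as) (free_vars \<phi>) \<delta> (map snd M)"
    unfolding fine_def
  proof
    fix v assume "v \<in> free_vars \<phi>"
    then obtain a where "map_of (zip vs as) v = Some a"
      using vs L by (metis map_of_zip_is_Some subsetD)
    then show "\<exists>K. map_of (map snd M) v = Some K \<and> assignment vs as v \<in> interval K \<and> width K < \<delta>"
      using K by (simp add: snd_M map_of_map assignment_def)
  qed
  then have "derivable formula_rule (\<phi>, map snd M)" by (rule \<delta>(1))
  moreover have "map fst M = as" "map (\<lambda>q. fst (snd q)) M = vs"
    using L by (simp_all add: M_def case_prod_beta comp_def)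
  moreover have "\<forall>q\<in>set M. fst (snd (snd q)) < fst q \<and> fst q < snd (snd (snd q))"
    using K(1) by (auto simp: M_def interval_def of_rat_less)
  ultimately show ?R by blast
next
  assume ?R
  then obtain M where M: "map fst M = as" "map (\<lambda>q. fst (snd q)) M = vs"
    "\<forall>q\<in>set M. fst (snd (snd q)) < fst q \<and> fst q < snd (snd (snd q))"
    "derivable formula_rule (\<phi>, map snd M)"
    by blast
  have "encloses (map snd M) (assignment vs as)"
    unfolding encloses_def
  proof (intro allI impI)
    fix v K assume "map_of (map snd M) v = Some K"
    \<comment> \<open>Both lookups take the first entry for v and hence meet the same triple of
      \<open>M\<close>.\<close>
    then have "\<exists>a. map_of (zip (map (\<lambda>q. fst (snd q)) M) (map fst M)) v = Some a \<and> (a, v, K) \<in> set M"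
      by (induction M) (auto split: if_splits)
    then show "assignment vs as v \<in> interval K"
      using M(3) unfolding M(1,2) by (fastforce simp: assignment_def interval_def of_rat_less)
  qed
  then have "satisfies (assignment vs as) \<phi>" using derivable_formula_sound[OF M(4) \<phi>(1)] by blast
  moreover have "length as = length vs" using M(1,2) by auto
  ultimately show ?L by (simp add: holds_at_def)
qed

theorem theorem8:
  shows "(\<forall>(\<phi> :: ex_formula) (vs :: nat list).
            over_ECF \<phi> \<and> equality_free \<phi> \<and> distinct vs \<and> free_vars \<phi> \<subseteq> set vs \<longrightarrow>
            re_rat_tuples {as. length as = length vs \<and> holds_at \<phi> vs as})
       \<and> ExistsR_ECF_less \<subseteq> Sigma01"
proof (intro conjI allI impI subsetI)
  fix \<phi> vs
  assume "over_ECF \<phi> \<and> equality_free \<phi> \<and> distinct vs \<and> free_vars \<phi> \<subseteq> set vs"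
  then have iff: "length as = length vs \<and> holds_at \<phi> vs as \<longleftrightarrow>
    (\<exists>M. map fst M = as \<and> map (\<lambda>q. fst (snd q)) M = vs \<and>
      (\<forall>q\<in>set M. fst (snd (snd q)) < fst q \<and> fst q < snd (snd (snd q))) \<and>
      derivable formula_rule (\<phi>, map snd M))" for as
    by (intro holds_at_iff_derivable) auto
  have "semidecidable (\<lambda>as. length as = length vs \<and> holds_at \<phi> vs as)"
    unfolding iff by (intro semidec semidecidable_comp[OF semidecidable_formula_rule])
  from semidecidable_re_nat[OF this]
  show "re_rat_tuples {as. length as = length vs \<and> holds_at \<phi> vs as}"
    unfolding re_rat_tuples_def enc_list_def enc_rat_def .
next
  fix L assume "L \<in> ExistsR_ECF_less"
  then obtain f where f: "polytime_computable f" "\<And>w. f w \<in> formula_word ` {\<phi>. ecf_less_sentence \<phi>}"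
    "\<And>w. w \<in> L \<longleftrightarrow> f w \<in> formula_word ` {\<phi>. ecf_less_sentence \<phi> \<and> holds_at \<phi> [] []}"
    by (auto simp: ExistsR_ECF_less_def ETR_ECF_less_def polytime_reducible_def)
  \<comment> \<open>The right-hand side never tests whether the function symbols in
    \<open>f w\<close> are valid codes. The reduction maps every word to an instance, which
    guarantees their validity.\<close>
  have "w \<in> L \<longleftrightarrow> (\<exists>\<phi>. f w = formula_word \<phi> \<and> derivable formula_rule (\<phi>, []))" for w
  proof -
    obtain \<phi> where \<phi>: "f w = formula_word \<phi>" "ecf_less_sentence \<phi>" using f(2)[of w] by auto
    have "holds_at \<phi> [] [] \<longleftrightarrow> derivable formula_rule (\<phi>, [])"
      using holds_at_iff_derivable[of \<phi> "[]" "[]"] \<phi>(2) by (auto simp: ecf_less_sentence_def)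
    then show ?thesis using f(3)[of w] \<phi> inj_formula_word by (auto simp: inj_eq)
  qed
  moreover have "semidecidable (\<lambda>w. \<exists>\<phi>. f w = formula_word \<phi> \<and> derivable formula_rule (\<phi>, []))"
    by (intro semidec semidecidable_comp[OF semidecidable_formula_rule]
      computable_comp[OF polytime_computable_imp_computable[OF f(1)]])
  ultimately have "semidecidable (\<lambda>w. w \<in> L)" by simp
  from semidecidable_re_nat[OF this] show "L \<in> Sigma01"
    by (simp add: Sigma01_def enc_list_def enc_bool_def[abs_def])
qed

end
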